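(* Let $\{q_k : k\ge 0\}$ be a non-increasing sequence of non-negative numbers with $q_0>0$ and $\lim_{n\to\infty}Q_n=\infty$, where $Q_n:=\sum_{k=0}^{n-1}q_k$ for $n\ge 1$. Let $t^{\ast}(f):=\sup_{n\ge 1}|t_n(f)|$ be the maximal operator of the associated Walsh-Nörlund means. Then the following three conditions are equivalent: (i) $t^{\ast}$ is bounded from $L_\infty(\mathbb{I})$ to $L_\infty(\mathbb{I})$; (ii) $t^{\ast}$ is bounded from $H_1(\mathbb{I})$ to $L_1(\mathbb{I})$; (iii) $\displaystyle\sup_{n\ge 1}\frac{1}{Q_n}\sum_{k=1}^{|n|}Q_{2^k}<\infty$, where $|n|:=\max\{j\in\mathbb{N}:\varepsilon_j(n)\ne 0\}$, that is, $2^{|n|}\le n<2^{|n|+1}$.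
   Context: $\mathbb{N}$ is the set of non-negative integers and $\mathbb{I}:=[0,1)$ with Lebesgue measure. For $x\in\mathbb{I}$ write $x=\sum_{n\ge 0}x_n2^{-(n+1)}$, $x_n\in\{0,1\}$, for its dyadic expansion (for dyadic rationals, the expansion terminating in zeros). For $n\in\mathbb{N}$ write $n=\sum_{k\ge 0}\varepsilon_k(n)2^k$, $\varepsilon_k(n)\in\{0,1\}$. The Walsh-Paley functions are $w_n(x)=(-1)^{\sum_{j\ge 0}\varepsilon_j(n)x_j}$. For $f\in L_1(\mathbb{I})$, $\widehat f(i)=\int_{\mathbb{I}}f(t)w_i(t)\,dt$ and $S_M(f;x)=\sum_{i=0}^{M-1}\widehat f(i)w_i(x)$. The Walsh-Nörlund means with weights $\{q_k\}$ are $t_n(f;x)=\frac{1}{Q_n}\sum_{k=1}^{n}q_{n-k}S_k(f;x)$ for $n\ge 1$. $L_1(\mathbb{I})$ carries the norm $\|f\|_1=\int_{\mathbb{I}}|f|$ and $L_\infty(\mathbb{I})$ the (essential) supremum norm. The maximal function is $E^{\ast}(f;x)=\sup_{n\in\mathbb{N}}|S_{2^n}(f;x)|$. The dyadic Hardy space $H_1(\mathbb{I})$ consists of all $f\in L_1(\mathbb{I})$ with $\|f\|_{H_1}:=\|E^{\ast}(f)\|_1<\infty$. "$t^{\ast}$ is bounded from $X$ to $Y$" means that there is a constant $c$ with $\|t^{\ast}(f)\|_Y\le c\|f\|_X$ for all $f\in X$. *)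

theory Defs
  imports "HOL-Probability.Essential_Supremum"
begin

abbreviation unit_measure :: "real measure" where
  "unit_measure \<equiv> lebesgue_on {0..<1}"

text \<open>The floor picks, for a dyadic rational, the expansion that terminates in zeros.\<close>

definition dyadic_digit :: "real \<Rightarrow> nat \<Rightarrow> nat" where
  "dyadic_digit x n = nat (\<lfloor>2 ^ (n + 1) * x\<rfloor> mod 2)"

lemma dyadic_digit_cases: "dyadic_digit x n \<in> {0, 1}"
  unfolding dyadic_digit_def by (cases "even \<lfloor>2 ^ (n + 1) * x\<rfloor>") (auto simp: odd_iff_mod_2_eq_one)

lemma dyadic_digit_partial_sum:
  assumes "0 \<le> x" "x < 1"
  shows "(\<Sum>k<n. real (dyadic_digit x k) / 2 ^ (k + 1)) = of_int \<lfloor>2 ^ n * x\<rfloor> / 2 ^ n"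
proof (induction n)
  case 0
  then show ?case using assms by (simp add: floor_eq_iff)
next
  case (Suc n)
  have "\<lfloor>2 ^ Suc n * x\<rfloor> div 2 = \<lfloor>2 ^ Suc n * x / 2\<rfloor>"
    using floor_divide_real_eq_div[of 2 "2 ^ Suc n * x"] by simp
  then have "\<lfloor>2 ^ Suc n * x\<rfloor> = 2 * \<lfloor>2 ^ n * x\<rfloor> + \<lfloor>2 ^ Suc n * x\<rfloor> mod 2"
    using div_mult_mod_eq[of "\<lfloor>2 ^ Suc n * x\<rfloor>" 2] by (simp add: mult_ac)
  moreover have "real (dyadic_digit x n) = of_int (\<lfloor>2 ^ Suc n * x\<rfloor> mod 2)"
    by (simp add: dyadic_digit_def)
  ultimately have "of_int \<lfloor>2 ^ Suc n * x\<rfloor> = 2 * of_int \<lfloor>2 ^ n * x\<rfloor> + real (dyadic_digit x n)"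
    by (metis of_int_add of_int_mult of_int_numeral)
  with Suc show ?case by (simp add: field_simps)
qed

lemma dyadic_digit_sums:
  assumes "0 \<le> x" "x < 1"
  shows "(\<lambda>n. real (dyadic_digit x n) / 2 ^ (n + 1)) sums x"
proof -
  have bound: "\<bar>of_int \<lfloor>2 ^ n * x\<rfloor> / 2 ^ n - x\<bar> \<le> (1 / 2) ^ n" for n
  proof -
    have "\<bar>of_int \<lfloor>2 ^ n * x\<rfloor> - 2 ^ n * x\<bar> \<le> 1" by linarith
    moreover have "of_int \<lfloor>2 ^ n * x\<rfloor> / 2 ^ n - x = (of_int \<lfloor>2 ^ n * x\<rfloor> - 2 ^ n * x) / 2 ^ n"
      by (simp add: field_simps)
    ultimately show ?thesis
      by (simp add: abs_divide power_one_over divide_right_mono)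
  qed
  have "(\<lambda>n. of_int \<lfloor>2 ^ n * x\<rfloor> / 2 ^ n - x) \<longlonglongrightarrow> 0"
    by (rule Lim_null_comparison[of _ "\<lambda>n. (1 / 2) ^ n"])
      (use bound in \<open>auto intro: LIMSEQ_power_zero\<close>)
  then show ?thesis
    unfolding sums_def dyadic_digit_partial_sum[OF assms] by (rule LIM_zero_cancel)
qed

text \<open>The exponent is the sum over \<open>j\<close> of (\<open>j\<close>-th binary digit of \<open>n\<close>) times (\<open>j\<close>-th dyadic
  digit of \<open>x\<close>), restricted to the finitely many \<open>j\<close> at which \<open>n\<close> has the digit 1.\<close>

definition walsh :: "nat \<Rightarrow> real \<Rightarrow> real" where
  "walsh n x = (- 1) ^ (\<Sum>j | bit n j. dyadic_digit x j)"

definition walsh_coeff :: "(real \<Rightarrow> real) \<Rightarrow> nat \<Rightarrow> real" where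
  "walsh_coeff f i = (LINT t|unit_measure. f t * walsh i t)"

definition walsh_partial_sum :: "nat \<Rightarrow> (real \<Rightarrow> real) \<Rightarrow> real \<Rightarrow> real" where
  "walsh_partial_sum M f x = (\<Sum>i<M. walsh_coeff f i * walsh i x)"

definition weight_sum :: "(nat \<Rightarrow> real) \<Rightarrow> nat \<Rightarrow> real" where
  "weight_sum q n = (\<Sum>k<n. q k)"

definition noerlund_mean :: "(nat \<Rightarrow> real) \<Rightarrow> nat \<Rightarrow> (real \<Rightarrow> real) \<Rightarrow> real \<Rightarrow> real" where
  "noerlund_mean q n f x =
     1 / weight_sum q n * (\<Sum>k = 1..n. q (n - k) * walsh_partial_sum k f x)"

text \<open>Maximal functions may take the value \<open>\<infinity>\<close>, so they and all norms are valued in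
  \<^typ>\<open>ennreal\<close>.\<close>

definition noerlund_maximal :: "(nat \<Rightarrow> real) \<Rightarrow> (real \<Rightarrow> real) \<Rightarrow> real \<Rightarrow> ennreal" where
  "noerlund_maximal q f x = (SUP n\<in>{1..}. ennreal \<bar>noerlund_mean q n f x\<bar>)"

definition dyadic_maximal :: "(real \<Rightarrow> real) \<Rightarrow> real \<Rightarrow> ennreal" where
  "dyadic_maximal f x = (SUP n. ennreal \<bar>walsh_partial_sum (2 ^ n) f x\<bar>)"

definition L1_norm :: "(real \<Rightarrow> ennreal) \<Rightarrow> ennreal" where
  "L1_norm g = (\<integral>\<^sup>+ x. g x \<partial>unit_measure)"

definition Linf_norm :: "(real \<Rightarrow> ennreal) \<Rightarrow> ennreal" where
  "Linf_norm g = esssup unit_measure g"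

definition H1_norm :: "(real \<Rightarrow> real) \<Rightarrow> ennreal" where
  "H1_norm f = L1_norm (dyadic_maximal f)"

definition Linf_space :: "(real \<Rightarrow> real) set" where
  "Linf_space = {f \<in> borel_measurable unit_measure. Linf_norm (\<lambda>x. ennreal \<bar>f x\<bar>) < \<infinity>}"

definition H1_space :: "(real \<Rightarrow> real) set" where
  "H1_space = {f. integrable unit_measure f \<and> H1_norm f < \<infinity>}"

definition bounded_between ::
  "(real \<Rightarrow> real) set \<Rightarrow> ((real \<Rightarrow> real) \<Rightarrow> ennreal) \<Rightarrow> ((real \<Rightarrow> ennreal) \<Rightarrow> ennreal)
    \<Rightarrow> ((real \<Rightarrow> real) \<Rightarrow> real \<Rightarrow> ennreal) \<Rightarrow> bool" where
  "bounded_between X normX normY T \<longleftrightarrow>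
     (\<exists>c::real. \<forall>f\<in>X. normY (T f) \<le> ennreal c * normX f)"

definition top_bit :: "nat \<Rightarrow> nat" where
  "top_bit n = Max {j. bit n j}"

end

theory Submission
  imports Defs "HOL-Probability.Probability_Measure"
begin

text \<open>
  Write \<open>Q\<close> for the partial sums of the weights. Summation by parts gives
  \<open>t\<^sub>n f = f * N\<^sub>n / Q\<^sub>n\<close>, a convolution on the dyadic group, with
  \<open>N\<^sub>n = (\<Sum>i<n. Q\<^sub>n\<^sub>-\<^sub>i w\<^sub>i)\<close>. Both boundedness properties are shown to be equivalent to the
  growth condition \<open>Q\<^sub>2 + Q\<^sub>4 + ... + Q(2\<^sup>m) \<le> C Q(2\<^sup>m)\<close>, which is the third condition
  restricted to powers of two.

  \<^bold>\<open>The kernel.\<close> If \<open>n = 2\<^sup>m + k\<close> with \<open>k < 2\<^sup>m\<close>, reflecting the first \<open>2\<^sup>m\<close> indices and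
  summing by parts yields \<open>N\<^sub>n = Q\<^sub>n D(2\<^sup>m) \<plusminus> N\<^sub>k \<plusminus> (\<Sum>i<2\<^sup>m. q(k+i) D\<^sub>i)\<close>
  (\<open>noerlund_kernel_power2_add\<close>). The last sum has decreasing weights, so Abel summation against
  \<open>D\<^sub>1 + ... + D\<^sub>i\<close>, that is \<open>i\<close> times a Fejer kernel, bounds it by
  \<open>(\<Sum>l<m. q(k+2\<^sup>l) R\<^sub>l)\<close> where \<open>R\<^sub>l \<ge> 0\<close> has integral \<open>2 \<cdot> 2\<^sup>l\<close>
  (\<open>abs_weighted_dirichlet_sum_le\<close>).

  \<^bold>\<open>Sufficiency.\<close> Under the growth condition \<open>Q(2\<^sup>l) / Q(2\<^sup>m)\<close> decays geometrically in \<open>m - l\<close>.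
  Iterating the recursion therefore gives one majorant for all \<open>n\<close> with top bit \<open>m\<close>:
  \<open>\<bar>N\<^sub>n\<bar> / Q\<^sub>n \<le> B (\<Sum>l\<le>m. \<kappa>\<^sup>m\<^sup>-\<^sup>l V\<^sub>l)\<close>, where \<open>V\<^sub>l = R\<^sub>l / 2\<^sup>l\<close> is a bump with integral 2 concentrated
  near \<open>[0, 2\<^sup>-\<^sup>l)\<close> (\<open>noerlund_kernel_majorant\<close>). Boundedness on \<open>L\<^sub>\<infinity>\<close> is immediate.
  On the Hardy space the cancellation of \<open>f\<close> enters through the maxima of its dyadic partial
  sums. For \<open>n\<close> with top bit \<open>m\<close> only \<open>S(2\<^sup>m\<^sup>+\<^sup>1) f\<close> enters \<open>t\<^sub>n f\<close>, and it is bounded by the running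
  maximum \<open>M\<^sub>m\<^sub>+\<^sub>1 = max \<bar>S(2\<^sup>k) f\<bar>\<close> over \<open>k \<le> m + 1\<close>. Since \<open>M\<^sub>k\<close> is constant on dyadic intervals of
  length \<open>2\<^sup>-\<^sup>k\<close>, the value \<open>M\<^sub>m\<^sub>+\<^sub>1 t\<close> exceeds \<open>M\<^sub>m\<^sub>+\<^sub>1 x\<close> only through the increments
  \<open>M\<^sub>k\<^sub>+\<^sub>1 t - M\<^sub>k t\<close> for which \<open>t\<close> lies outside the dyadic interval of length \<open>2\<^sup>-\<^sup>k\<^sup>-\<^sup>1\<close> around \<open>x\<close>.
  The first part is at most the dyadic maximal function. In the second part the supremum over \<open>m\<close>
  may be replaced by a sum, because the mass of the \<open>m\<close>-th majorant outside that interval is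
  summable over \<open>m \<ge> k\<close>, uniformly in \<open>k\<close>, and the increments telescope
  (\<open>H1_bounded_of_growth\<close>).

  \<^bold>\<open>Necessity.\<close> Each boundedness property bounds \<open>\<parallel>N\<^sub>n\<parallel>\<^sub>1 / Q\<^sub>n\<close>: test with the sign of the kernel,
  and with the atom \<open>w(2\<^sup>A) D(2\<^sup>A)\<close>, respectively. For \<open>n = 1 + 4 + ... + 4\<^sup>s\<^sup>-\<^sup>1\<close> the errors in the
  recursion telescope to \<open>O(Q\<^sub>n)\<close>, while the main terms sit at scales a factor 4 apart and
  cannot cancel; this gives \<open>\<parallel>N\<^sub>n\<parallel>\<^sub>1 \<ge> c (\<Sum>i<s. Q(4\<^sup>i)) - C Q\<^sub>n\<close>
  (\<open>sum_weights_le_kernel_norm\<close>), hence the growth condition.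

  All kernels are polynomials in the Rademacher signs, so they are treated as functions of a sign
  sequence. Convolution then means inserting the product of the signs of \<open>x\<close> and \<open>t\<close>, and every
  integral that is needed follows from the orthonormality of the Walsh functions.
\<close>

section \<open>Rademacher signs and Walsh characters\<close>

definition rademacher :: "real \<Rightarrow> nat \<Rightarrow> real" where
  "rademacher x j = (- 1) ^ dyadic_digit x j"

text \<open>The \<open>n\<close>-th character of the dyadic group at the point with Rademacher signs \<open>\<sigma>\<close>. Sign
  sequences replace points of the unit interval, because the pointwise kernel identities are
  purely algebraic in the signs.\<close>
definition walsh_char :: "(nat \<Rightarrow> real) \<Rightarrow> nat \<Rightarrow> real" where
  "walsh_char \<sigma> n = (\<Prod>j | bit n j. \<sigma> j)"

definition signs :: "(nat \<Rightarrow> real) \<Rightarrow> bool" where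
  "signs \<sigma> \<longleftrightarrow> (\<forall>j. \<sigma> j = 1 \<or> \<sigma> j = - 1)"

text \<open>The signs of the quotient of \<open>x\<close> and \<open>t\<close> in the dyadic group, which is also their product since all
  elements are involutions. The corresponding real number is avoided, because its digitwise expansion
  may end in ones.\<close>
definition dyadic_quotient :: "real \<Rightarrow> real \<Rightarrow> nat \<Rightarrow> real" where
  "dyadic_quotient x t j = rademacher x j * rademacher t j"

lemma signs_abs: "signs \<sigma> \<Longrightarrow> \<bar>\<sigma> j\<bar> = 1"
  unfolding signs_def by (metis abs_1 abs_minus_cancel)

lemma signs_rademacher: "signs (rademacher x)"
  unfolding signs_def rademacher_def by (meson neg_one_even_power neg_one_odd_power)

lemma signs_dyadic_quotient: "signs (dyadic_quotient x t)"
  using signs_rademacher[of x] signs_rademacher[of t]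
  unfolding signs_def dyadic_quotient_def by (metis mult_1 mult_minus1 minus_minus)

lemma walsh_eq_walsh_char: "walsh n x = walsh_char (rademacher x) n"
  by (simp add: walsh_def walsh_char_def rademacher_def power_sum)

lemma walsh_char_dyadic_quotient:
  "walsh_char (dyadic_quotient x t) n = walsh n x * walsh n t"
  by (simp add: walsh_eq_walsh_char walsh_char_def dyadic_quotient_def prod.distrib)

lemma abs_walsh_char: "signs \<sigma> \<Longrightarrow> \<bar>walsh_char \<sigma> n\<bar> = 1"
  unfolding walsh_char_def abs_prod by (rule prod.neutral) (simp add: signs_abs)

lemma walsh_char_0 [simp]: "walsh_char \<sigma> 0 = 1"
  by (simp add: walsh_char_def)

lemma bits_power2_add:
  assumes "i < 2 ^ m"
  shows "{j. bit (2 ^ m + i) j} = insert m {j. bit (i::nat) j}" and "\<not> bit i m"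
proof -
  have i: "take_bit m i = i" using assms by (simp add: take_bit_nat_eq_self)
  show nb: "\<not> bit i m" by (metis i bit_take_bit_iff less_irrefl)
  have "2 ^ m + i = or (2 ^ m) i"
    by (rule disjunctive_add) (use nb in \<open>auto simp: bit_exp_iff\<close>)
  then show "{j. bit (2 ^ m + i) j} = insert m {j. bit i j}"
    by (auto simp: bit_or_iff bit_exp_iff)
qed

lemma bit_imp_power_le: "bit (n::nat) j \<Longrightarrow> 2 ^ j \<le> n"
  by (rule ccontr) (simp add: bit_iff_odd)

lemma bit_imp_less:
  assumes "bit (i::nat) j" "i < 2 ^ k"
  shows "j < k"
proof -
  have "(2::nat) ^ j < 2 ^ k" by (rule le_less_trans[OF bit_imp_power_le[OF assms(1)] assms(2)])
  then show ?thesis by simp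
qed

lemma finite_bits: "finite {j. bit (n::nat) j}"
  by (rule finite_subset[of _ "{..<n}"]) (auto intro: bit_imp_less less_exp)

lemma walsh_char_power2_add:
  assumes "i < 2 ^ m"
  shows "walsh_char \<sigma> (2 ^ m + i) = \<sigma> m * walsh_char \<sigma> i"
  unfolding walsh_char_def bits_power2_add(1)[OF assms]
  using bits_power2_add(2)[OF assms] finite_bits by simp

text \<open>The binary digits of \<open>2\<^sup>m - 1 - i\<close> are the complements of those of \<open>i\<close>, so on indices below
  \<open>2\<^sup>m\<close> reflection is multiplication by the top character.\<close>
lemma walsh_char_reflect:
  assumes "signs \<sigma>" "i < 2 ^ m"
  shows "walsh_char \<sigma> (2 ^ m - 1 - i) = walsh_char \<sigma> (2 ^ m - 1) * walsh_char \<sigma> i"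
  using assms(2)
proof (induction m arbitrary: i)
  case 0
  then show ?case by simp
next
  case (Suc m)
  have sq: "\<sigma> m * \<sigma> m = 1" using signs_abs[OF assms(1), of m] by (metis abs_mult_self_eq mult_1)
  have top: "walsh_char \<sigma> (2 ^ Suc m - 1) = \<sigma> m * walsh_char \<sigma> (2 ^ m - 1)"
    using walsh_char_power2_add[of "2 ^ m - 1" m \<sigma>] by (simp add: mult_2)
  show ?case
  proof (cases "i < 2 ^ m")
    case True
    have "2 ^ Suc m - 1 - i = 2 ^ m + (2 ^ m - 1 - i)" using True by simp
    moreover have "2 ^ m - 1 - i < (2::nat) ^ m" by (simp add: less_imp_diff_less)
    ultimately show ?thesis using Suc.IH[OF True] top by (simp add: walsh_char_power2_add)
  next
    case False
    then obtain i' where i: "i = 2 ^ m + i'" by (metis le_add_diff_inverse not_less)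
    with Suc.prems have i': "i' < 2 ^ m" by simp
    have "2 ^ Suc m - 1 - i = 2 ^ m - 1 - i'" using i by simp
    then show ?thesis using Suc.IH[OF i'] top sq unfolding i
      by (simp add: walsh_char_power2_add[OF i'] mult_ac)
  qed
qed

lemma dyadic_digit_Suc: "dyadic_digit x (Suc n) = dyadic_digit (2 * x) n"
  by (simp add: dyadic_digit_def mult_ac)

lemma dyadic_digit_diff_1: "dyadic_digit (x - 1) n = dyadic_digit x n"
proof -
  have "\<lfloor>2 ^ (n + 1) * (x - 1)\<rfloor> = \<lfloor>2 ^ (n + 1) * x - of_int (2 ^ (n + 1))\<rfloor>"
    by (simp add: algebra_simps)
  also have "\<dots> = \<lfloor>2 ^ (n + 1) * x\<rfloor> - 2 ^ (n + 1)" by (rule floor_diff_of_int)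
  finally have "\<lfloor>2 ^ (n + 1) * (x - 1)\<rfloor> mod 2 = \<lfloor>2 ^ (n + 1) * x\<rfloor> mod 2"
    by (simp add: mod_diff_eq[symmetric])
  then show ?thesis by (simp add: dyadic_digit_def)
qed

lemma walsh_diff_1: "walsh n (x - 1) = walsh n x"
  by (simp add: walsh_def dyadic_digit_diff_1)

lemma walsh_double:
  "walsh n x = (if odd n then rademacher x 0 else 1) * walsh (n div 2) (2 * x)"
proof -
  have "{j. bit n j} = (if odd n then {0} else {}) \<union> Suc ` {j. bit (n div 2) j}"
    by (auto simp: bit_0 bit_Suc image_iff elim: nat.exhaust) (metis bit_0 bit_Suc not0_implies_Suc)+
  then show ?thesis
    by (auto simp: walsh_eq_walsh_char walsh_char_def rademacher_def prod.reindex dyadic_digit_Suc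
        finite_bits prod.union_disjoint)
qed

lemma walsh_measurable [measurable]: "walsh n \<in> borel_measurable borel"
proof -
  have [measurable]: "(\<lambda>x. rademacher x j) \<in> borel_measurable borel" for j
    unfolding rademacher_def dyadic_digit_def by measurable
  show ?thesis unfolding walsh_eq_walsh_char walsh_char_def by measurable
qed

lemma unit_measure_prob: "prob_space unit_measure"
  by (rule prob_spaceI) (simp add: emeasure_restrict_space)

interpretation unit: prob_space unit_measure by (rule unit_measure_prob)

lemma borel_measurable_unit:
  "f \<in> borel_measurable borel \<Longrightarrow> (f::real \<Rightarrow> real) \<in> borel_measurable unit_measure"
  by (intro measurable_restrict_space1 measurable_completion) simp

lemma integrable_bounded:
  fixes f :: "real \<Rightarrow> real"
  assumes "f \<in> borel_measurable unit_measure" "\<And>x. \<bar>f x\<bar> \<le> B"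
  shows "integrable unit_measure f"
  using assms by (intro unit.integrable_const_bound[where B = B]) auto

lemma lebesgue_integral_unit:
  assumes "f \<in> borel_measurable borel"
  shows "(LINT x|unit_measure. f x) = (LINT x|lborel. indicator {0..<1} x * (f x :: real))"
  using assms by (simp add: integral_restrict_space integral_completion)

text \<open>Scaling by 2 maps each half of the unit interval onto a period. This turns integrals of Walsh
  functions into an induction on the index, since \<open>w\<^sub>n x = \<plusminus> w(n div 2)(2 x)\<close>.\<close>
lemma integral_unit_halves:
  fixes g :: "real \<Rightarrow> real"
  assumes [measurable]: "g \<in> borel_measurable borel" and b: "\<And>x. \<bar>g x\<bar> \<le> 1"
    and per: "\<And>x. g (x - 1) = g x"
  shows "(LINT x|unit_measure. (if x < 1 / 2 then 1 else c) * g (2 * x))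
    = (1 + c) / 2 * (LINT x|unit_measure. g x)"
proof -
  define h where "h x = indicator {0..<1} x * g x" for x
  have [measurable]: "h \<in> borel_measurable borel" unfolding h_def by measurable
  have int: "integrable lborel h"
    using integrableI_bounded_set_indicator[of "{0..<1}" lborel g 1] b by (simp add: h_def[abs_def])
  have pt: "indicator {0..<1} x * ((if x < 1 / 2 then 1 else c) * g (2 * x)) = h (0 + 2 * x) + c * h (- 1 + 2 * x)" for x
    using per[of "2 * x"] by (auto simp: h_def indicator_def add.commute)
  have i1: "integrable lborel (\<lambda>x. h (0 + 2 * x))" "integrable lborel (\<lambda>x. h (- 1 + 2 * x))"
    using int by (simp_all only: lborel_integrable_real_affine_iff[of 2])
  have e: "(LINT x|lborel. h (0 + 2 * x)) = (LINT x|lborel. h x) / 2"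
    "(LINT x|lborel. h (- 1 + 2 * x)) = (LINT x|lborel. h x) / 2"
    using lborel_integral_real_affine[of 2 h 0] lborel_integral_real_affine[of 2 h "- 1"] by simp_all
  have "(LINT x|unit_measure. (if x < 1 / 2 then 1 else c) * g (2 * x))
      = (LINT x|lborel. h (0 + 2 * x) + c * h (- 1 + 2 * x))"
    by (subst lebesgue_integral_unit) (simp_all only: pt, measurable)
  also have "\<dots> = (1 + c) / 2 * (LINT x|lborel. h x)"
    using i1 by (subst Bochner_Integration.integral_add) (simp_all only: integral_mult_right_zero e
        integrable_mult_right, simp add: algebra_simps)
  also have "(LINT x|lborel. h x) = (LINT x|unit_measure. g x)"
    by (simp add: lebesgue_integral_unit h_def)
  finally show ?thesis .
qed

lemma abs_walsh: "\<bar>walsh n x\<bar> = 1"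
  by (simp add: walsh_eq_walsh_char abs_walsh_char signs_rademacher)

lemma walsh_orthonormal:
  "(LINT x|unit_measure. walsh i x * walsh j x) = (if i = j then 1 else 0)"
proof (induction "i + j" arbitrary: i j rule: less_induct)
  case less
  show ?case
  proof (cases "i + j = 0")
    case True
    then show ?thesis using unit.prob_space by (simp add: walsh_def)
  next
    case False
    define c :: real where "c = (if even (i + j) then 1 else - 1)"
    have r: "rademacher x 0 = (if x < 1 / 2 then 1 else - 1)" if "x \<in> {0..<1}" for x
    proof (cases "x < 1 / 2")
      case True
      then have "\<lfloor>2 * x\<rfloor> = 0" using that by (simp add: floor_eq_iff)
      then show ?thesis using True by (simp add: rademacher_def dyadic_digit_def)
    next
      case False
      then have "\<lfloor>2 * x\<rfloor> = 1" using that by (simp add: floor_eq_iff)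
      then show ?thesis using False by (simp add: rademacher_def dyadic_digit_def)
    qed
    have "(LINT x|unit_measure. walsh i x * walsh j x)
      = (LINT x|unit_measure. (if x < 1 / 2 then 1 else c)
          * (walsh (i div 2) (2 * x) * walsh (j div 2) (2 * x)))"
      by (rule Bochner_Integration.integral_cong)
        (auto simp: walsh_double[of i] walsh_double[of j] r c_def)
    also have "\<dots> = (1 + c) / 2 * (LINT x|unit_measure. walsh (i div 2) x * walsh (j div 2) x)"
      by (rule integral_unit_halves) (auto simp: abs_mult abs_walsh walsh_diff_1)
    also have "(LINT x|unit_measure. walsh (i div 2) x * walsh (j div 2) x)
        = (if i div 2 = j div 2 then 1 else 0)"
    proof (rule less)
      have "i \<noteq> 0 \<Longrightarrow> i div 2 < i" "j \<noteq> 0 \<Longrightarrow> j div 2 < j" by simp_all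
      then show "i div 2 + j div 2 < i + j"
        using False by (cases "i = 0"; cases "j = 0") auto
    qed
    also have "(1 + c) / 2 * (if i div 2 = j div 2 then 1 else 0) = (if i = j then 1 else 0)"
      unfolding c_def bit_eq_rec[of i j] by simp
    finally show ?thesis .
  qed
qed

section \<open>Dirichlet and Fejer kernels\<close>

definition dirichlet :: "(nat \<Rightarrow> real) \<Rightarrow> nat \<Rightarrow> real" where
  "dirichlet \<sigma> n = (\<Sum>i<n. walsh_char \<sigma> i)"

text \<open>This is \<open>n\<close> times the \<open>n\<close>-th Walsh-Fejer kernel.\<close>
definition fejer_sum :: "(nat \<Rightarrow> real) \<Rightarrow> nat \<Rightarrow> real" where
  "fejer_sum \<sigma> n = (\<Sum>k = 1..n. dirichlet \<sigma> k)"

text \<open>The kernel of the \<open>n\<close>-th mean without the factor \<open>1 / Q\<^sub>n\<close>; see \<open>noerlund_mean_eq_integral\<close>.\<close>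
definition noerlund_kernel :: "(nat \<Rightarrow> real) \<Rightarrow> (nat \<Rightarrow> real) \<Rightarrow> nat \<Rightarrow> real" where
  "noerlund_kernel q \<sigma> n = (\<Sum>i<n. weight_sum q (n - i) * walsh_char \<sigma> i)"

lemma sum_lessThan_add:
  fixes f :: "nat \<Rightarrow> real"
  shows "(\<Sum>i<m + k. f i) = (\<Sum>i<m. f i) + (\<Sum>i<k. f (m + i))"
  by (induction k) auto

lemma dirichlet_power2_add:
  assumes "k \<le> 2 ^ m"
  shows "dirichlet \<sigma> (2 ^ m + k) = dirichlet \<sigma> (2 ^ m) + \<sigma> m * dirichlet \<sigma> k"
proof -
  have "(\<Sum>i<k. walsh_char \<sigma> (2 ^ m + i)) = (\<Sum>i<k. \<sigma> m * walsh_char \<sigma> i)"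
    by (rule sum.cong) (use assms in \<open>auto intro: walsh_char_power2_add\<close>)
  then show ?thesis by (simp add: dirichlet_def sum_lessThan_add sum_distrib_left)
qed

lemma dirichlet_power2_Suc: "dirichlet \<sigma> (2 ^ Suc m) = (1 + \<sigma> m) * dirichlet \<sigma> (2 ^ m)"
  using dirichlet_power2_add[of "2 ^ m" m \<sigma>] by (simp add: mult_2 algebra_simps)

lemma dirichlet_power2:
  assumes "signs \<sigma>"
  shows "dirichlet \<sigma> (2 ^ m) = (if \<forall>j<m. \<sigma> j = 1 then 2 ^ m else 0)"
proof (induction m)
  case 0
  then show ?case by (simp add: dirichlet_def)
next
  case (Suc m)
  have "\<sigma> m = 1 \<or> \<sigma> m = - 1" using assms by (simp add: signs_def)
  then show ?case unfolding dirichlet_power2_Suc Suc by (auto simp: less_Suc_eq)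
qed

lemma fejer_sum_power2_add:
  assumes "k \<le> 2 ^ m"
  shows "fejer_sum \<sigma> (2 ^ m + k)
    = fejer_sum \<sigma> (2 ^ m) + real k * dirichlet \<sigma> (2 ^ m) + \<sigma> m * fejer_sum \<sigma> k"
  using assms
proof (induction k)
  case 0
  then show ?case by (simp add: fejer_sum_def)
next
  case (Suc k)
  have "fejer_sum \<sigma> (2 ^ m + Suc k) = fejer_sum \<sigma> (2 ^ m + k) + dirichlet \<sigma> (2 ^ m + Suc k)"
    by (simp add: fejer_sum_def)
  moreover have "fejer_sum \<sigma> (Suc k) = fejer_sum \<sigma> k + dirichlet \<sigma> (Suc k)"
    by (simp add: fejer_sum_def)
  ultimately show ?case
    using Suc dirichlet_power2_add[OF Suc.prems, of \<sigma>] by (simp add: algebra_simps)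
qed

lemma fejer_sum_power2_Suc:
  "fejer_sum \<sigma> (2 ^ Suc m) = (1 + \<sigma> m) * fejer_sum \<sigma> (2 ^ m) + 2 ^ m * dirichlet \<sigma> (2 ^ m)"
  using fejer_sum_power2_add[of "2 ^ m" m \<sigma>] by (simp add: mult_2 algebra_simps)

lemma dirichlet_power2_bounds:
  assumes "signs \<sigma>"
  shows "0 \<le> dirichlet \<sigma> (2 ^ m)" "dirichlet \<sigma> (2 ^ m) \<le> 2 ^ m"
  using dirichlet_power2[OF assms, of m] by auto

text \<open>Because of positivity the \<open>L\<^sub>1\<close> norm of such a kernel is its mean value, the zeroth Walsh
  coefficient.\<close>
lemma fejer_sum_power2_nonneg:
  assumes "signs \<sigma>"
  shows "0 \<le> fejer_sum \<sigma> (2 ^ m)"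
proof (induction m)
  case 0
  then show ?case by (simp add: fejer_sum_def dirichlet_def)
next
  case (Suc m)
  have "0 \<le> 1 + \<sigma> m" using signs_abs[OF assms, of m] by linarith
  then show ?case
    unfolding fejer_sum_power2_Suc using Suc dirichlet_power2_bounds(1)[OF assms] by simp
qed

text \<open>The contribution of the binary digit \<open>2\<^sup>l\<close> of \<open>i\<close> when \<open>fejer_sum \<sigma> i\<close> is expanded along the
  binary digits of \<open>i\<close>.\<close>
definition fejer_block :: "(nat \<Rightarrow> real) \<Rightarrow> nat \<Rightarrow> real" where
  "fejer_block \<sigma> l = fejer_sum \<sigma> (2 ^ l) + 2 ^ l * dirichlet \<sigma> (2 ^ l)"

lemma fejer_block_nonneg: "signs \<sigma> \<Longrightarrow> 0 \<le> fejer_block \<sigma> l"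
  by (simp add: fejer_block_def fejer_sum_power2_nonneg dirichlet_power2_bounds)

text \<open>Splitting off the leading binary digit repeatedly; all powers of two up to \<open>i\<close> are admitted
  instead of only the digits of \<open>i\<close>, which makes the bound monotone in \<open>i\<close> as required for
  \<open>abel_majorant\<close>.\<close>
lemma abs_fejer_sum_le:
  assumes "signs \<sigma>" "i < 2 ^ m"
  shows "\<bar>fejer_sum \<sigma> i\<bar> \<le> (\<Sum>l<m. if 2 ^ l \<le> i then fejer_block \<sigma> l else 0)"
  using assms(2)
proof (induction m arbitrary: i)
  case 0
  then show ?case by (simp add: fejer_sum_def)
next
  case (Suc m)
  show ?case
  proof (cases "i < 2 ^ m")
    case True
    then show ?thesis using Suc.IH[OF True] by simp
  next
    case False
    then obtain i' where i: "i = 2 ^ m + i'" by (metis le_add_diff_inverse not_less)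
    with Suc.prems have i': "i' < 2 ^ m" by simp
    have s: "\<bar>\<sigma> m\<bar> = 1" by (rule signs_abs[OF assms(1)])
    have "\<bar>fejer_sum \<sigma> i\<bar> \<le> \<bar>fejer_sum \<sigma> (2 ^ m)\<bar> + \<bar>real i' * dirichlet \<sigma> (2 ^ m)\<bar> + \<bar>\<sigma> m * fejer_sum \<sigma> i'\<bar>"
      unfolding i fejer_sum_power2_add[OF less_imp_le[OF i']] by linarith
    also have "\<bar>fejer_sum \<sigma> (2 ^ m)\<bar> = fejer_sum \<sigma> (2 ^ m)"
      using fejer_sum_power2_nonneg[OF assms(1)] by simp
    also have "\<bar>real i' * dirichlet \<sigma> (2 ^ m)\<bar> = real i' * dirichlet \<sigma> (2 ^ m)"
      using dirichlet_power2_bounds(1)[OF assms(1)] by simp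
    also have "\<dots> \<le> 2 ^ m * dirichlet \<sigma> (2 ^ m)"
      using i' dirichlet_power2_bounds(1)[OF assms(1)]
      by (intro mult_right_mono) simp_all
    also have "\<bar>\<sigma> m * fejer_sum \<sigma> i'\<bar> = \<bar>fejer_sum \<sigma> i'\<bar>" by (simp add: abs_mult s)
    also have "\<dots> \<le> (\<Sum>l<m. if 2 ^ l \<le> i' then fejer_block \<sigma> l else 0)" by (rule Suc.IH[OF i'])
    also have "\<dots> \<le> (\<Sum>l<m. if 2 ^ l \<le> i then fejer_block \<sigma> l else 0)"
      by (rule sum_mono) (use i fejer_block_nonneg[OF assms(1)] in auto)
    finally show ?thesis using i by (simp add: fejer_block_def add_ac)
  qed
qed

lemma summation_by_parts:
  fixes s d :: "nat \<Rightarrow> real"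
  shows "(\<Sum>i = 1..k. s i * d i)
    = (\<Sum>i = 1..k. (s i - s (Suc i)) * (\<Sum>j = 1..i. d j)) + s (Suc k) * (\<Sum>j = 1..k. d j)"
  by (induction k) (simp_all add: algebra_simps)

text \<open>After summation by parts all coefficients are nonnegative, so a bound for the partial sums of
  \<open>d\<close> may be inserted and the summation undone.\<close>
lemma abel_majorant:
  fixes s d b :: "nat \<Rightarrow> real"
  assumes "\<And>i. s (Suc i) \<le> s i" "\<And>i. 0 \<le> s i"
    and le: "\<And>i. i \<le> k \<Longrightarrow> \<bar>\<Sum>j = 1..i. d j\<bar> \<le> (\<Sum>j = 1..i. b j)"
  shows "\<bar>\<Sum>i = 1..k. s i * d i\<bar> \<le> (\<Sum>i = 1..k. s i * b i)"
proof -
  have "\<bar>\<Sum>i = 1..k. s i * d i\<bar>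
      \<le> \<bar>\<Sum>i = 1..k. (s i - s (Suc i)) * (\<Sum>j = 1..i. d j)\<bar> + \<bar>s (Suc k) * (\<Sum>j = 1..k. d j)\<bar>"
    unfolding summation_by_parts[of s d] by (rule abs_triangle_ineq)
  also have "\<bar>\<Sum>i = 1..k. (s i - s (Suc i)) * (\<Sum>j = 1..i. d j)\<bar>
      \<le> (\<Sum>i = 1..k. (s i - s (Suc i)) * (\<Sum>j = 1..i. b j))"
    by (rule order_trans[OF sum_abs sum_mono])
      (use assms(1) le in \<open>auto simp: abs_mult simp del: One_nat_def intro!: mult_left_mono\<close>)
  also have "\<bar>s (Suc k) * (\<Sum>j = 1..k. d j)\<bar> \<le> s (Suc k) * (\<Sum>j = 1..k. b j)"
    using le[of k] assms by (auto simp: abs_mult intro!: mult_left_mono)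
  finally show ?thesis unfolding summation_by_parts[of s b] by simp
qed

text \<open>The gain over the triangle inequality is that only Fejer-type kernels, with bounded
  \<open>L\<^sub>1\<close> norms, occur on the right; the Dirichlet kernels themselves have unbounded norms.\<close>
lemma abs_weighted_dirichlet_sum_le:
  assumes "signs \<sigma>" "\<And>i. s (Suc i) \<le> s i" "\<And>i. 0 \<le> (s i :: real)"
  shows "\<bar>\<Sum>i = 1..2 ^ m - 1. s i * dirichlet \<sigma> i\<bar> \<le> (\<Sum>l<m. s (2 ^ l) * fejer_block \<sigma> l)"
proof -
  define b where "b i = (\<Sum>l<m. if i = 2 ^ l then fejer_block \<sigma> l else 0)" for i :: nat
  have sum_b: "(\<Sum>i = 1..k. c i * b i)
      = (\<Sum>l<m. if 2 ^ l \<le> k then c (2 ^ l) * fejer_block \<sigma> l else 0)" for k and c :: "nat \<Rightarrow> real"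
  proof -
    have "(\<Sum>i = 1..k. c i * b i)
      = (\<Sum>i = 1..k. \<Sum>l<m. if i = 2 ^ l then c (2 ^ l) * fejer_block \<sigma> l else 0)"
      unfolding b_def sum_distrib_left by (intro sum.cong) auto
    also have "\<dots> = (\<Sum>l<m. \<Sum>i = 1..k. if i = 2 ^ l then c (2 ^ l) * fejer_block \<sigma> l else 0)"
      by (rule sum.swap)
    also have "\<dots> = (\<Sum>l<m. if 2 ^ l \<le> k then c (2 ^ l) * fejer_block \<sigma> l else 0)"
      by (intro sum.cong) (auto simp: sum.delta)
    finally show ?thesis .
  qed
  have "\<bar>\<Sum>i = 1..2 ^ m - 1. s i * dirichlet \<sigma> i\<bar> \<le> (\<Sum>i = 1..2 ^ m - 1. s i * b i)"
  proof (rule abel_majorant)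
    fix i :: nat assume "i \<le> 2 ^ m - 1"
    moreover have "(0::nat) < 2 ^ m" by simp
    ultimately have "i < 2 ^ m" by linarith
    then show "\<bar>\<Sum>j = 1..i. dirichlet \<sigma> j\<bar> \<le> (\<Sum>j = 1..i. b j)"
      using abs_fejer_sum_le[OF assms(1) \<open>i < 2 ^ m\<close>] sum_b[of "\<lambda>_. 1" i]
      by (simp only: fejer_sum_def mult_1)
  qed (use assms in auto)
  also have "\<dots> \<le> (\<Sum>l<m. s (2 ^ l) * fejer_block \<sigma> l)"
    unfolding sum_b by (rule sum_mono) (use assms fejer_block_nonneg in auto)
  finally show ?thesis .
qed

section \<open>A recursion for the Noerlund kernels\<close>

lemma weight_sum_add: "weight_sum q (m + k) = weight_sum q m + (\<Sum>i<k. q (m + i))"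
  by (simp add: weight_sum_def sum_lessThan_add)

lemma sum_reflected_weights:
  assumes "m > 0"
  shows "(\<Sum>i<m. weight_sum q (a + 1 + i) * w i)
    = weight_sum q (a + m) * (\<Sum>i<m. w i) - (\<Sum>i = 1..m - 1. q (a + i) * (\<Sum>j<i. w j))"
  using assms
proof (induction m rule: nat_induct_non_zero)
  case 1
  then show ?case by simp
next
  case (Suc m)
  have e: "(\<Sum>i = 1..Suc m - 1. q (a + i) * (\<Sum>j<i. w j))
      = (\<Sum>i = 1..m - 1. q (a + i) * (\<Sum>j<i. w j)) + q (a + m) * (\<Sum>j<m. w j)"
    using Suc by (cases m) auto
  have "weight_sum q (a + Suc m) = weight_sum q (a + m) + q (a + m)"
    by (simp add: weight_sum_def)
  then show ?case using Suc.IH unfolding e by (simp add: algebra_simps)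
qed

text \<open>Stripping the leading binary digit. The terms with index below \<open>2\<^sup>m\<close> are reflected, so that
  their coefficients increase, and then summed by parts; on the remaining terms the character of
  \<open>2\<^sup>m\<close> factors out.\<close>
lemma noerlund_kernel_power2_add:
  assumes "signs \<sigma>" "k < 2 ^ m"
  shows "noerlund_kernel q \<sigma> (2 ^ m + k)
    = weight_sum q (2 ^ m + k) * dirichlet \<sigma> (2 ^ m) + \<sigma> m * noerlund_kernel q \<sigma> k
      - walsh_char \<sigma> (2 ^ m - 1) * (\<Sum>i = 1..2 ^ m - 1. q (k + i) * dirichlet \<sigma> i)"
proof -
  let ?w = "walsh_char \<sigma> (2 ^ m - 1)"
  have "(\<Sum>i<2 ^ m. weight_sum q (2 ^ m + k - i) * walsh_char \<sigma> i)
      = (\<Sum>i<2 ^ m. weight_sum q (2 ^ m + k - (2 ^ m - Suc i)) * walsh_char \<sigma> (2 ^ m - Suc i))"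
    by (rule sum.nat_diff_reindex[symmetric])
  also have "\<dots> = (\<Sum>i<2 ^ m. ?w * (weight_sum q (k + 1 + i) * walsh_char \<sigma> i))"
  proof (rule sum.cong)
    fix i :: nat assume "i \<in> {..<2 ^ m}"
    then have i: "i < 2 ^ m" by simp
    have "2 ^ m + k - (2 ^ m - Suc i) = k + 1 + i" using i by linarith
    moreover have "walsh_char \<sigma> (2 ^ m - Suc i) = ?w * walsh_char \<sigma> i"
      using walsh_char_reflect[OF assms(1) i] by simp
    ultimately show "weight_sum q (2 ^ m + k - (2 ^ m - Suc i)) * walsh_char \<sigma> (2 ^ m - Suc i)
        = ?w * (weight_sum q (k + 1 + i) * walsh_char \<sigma> i)" by simp
  qed simp
  also have "\<dots> = ?w * (weight_sum q (k + 2 ^ m) * dirichlet \<sigma> (2 ^ m)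
      - (\<Sum>i = 1..2 ^ m - 1. q (k + i) * dirichlet \<sigma> i))"
    unfolding sum_distrib_left[symmetric] dirichlet_def by (subst sum_reflected_weights) auto
  also have "\<dots> = weight_sum q (2 ^ m + k) * (?w * dirichlet \<sigma> (2 ^ m))
      - ?w * (\<Sum>i = 1..2 ^ m - 1. q (k + i) * dirichlet \<sigma> i)"
    by (simp add: algebra_simps)
  \<comment> \<open>Where the Dirichlet kernel does not vanish, all characters below \<open>2\<^sup>m\<close> are 1.\<close>
  also have "?w * dirichlet \<sigma> (2 ^ m) = dirichlet \<sigma> (2 ^ m)"
  proof (cases "\<forall>j<m. \<sigma> j = 1")
    case True
    have "j < m" if "bit (2 ^ m - 1 :: nat) j" for j
      using that by (metis bit_mask_iff mask_eq_exp_minus_1)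
    then have "?w = 1" unfolding walsh_char_def by (intro prod.neutral) (use True in auto)
    then show ?thesis by simp
  next
    case False
    then show ?thesis using dirichlet_power2[OF assms(1), of m] by auto
  qed
  finally have head: "(\<Sum>i<2 ^ m. weight_sum q (2 ^ m + k - i) * walsh_char \<sigma> i)
    = weight_sum q (2 ^ m + k) * dirichlet \<sigma> (2 ^ m)
      - ?w * (\<Sum>i = 1..2 ^ m - 1. q (k + i) * dirichlet \<sigma> i)" .
  have tail: "(\<Sum>i<k. weight_sum q (2 ^ m + k - (2 ^ m + i)) * walsh_char \<sigma> (2 ^ m + i))
      = \<sigma> m * noerlund_kernel q \<sigma> k"
    unfolding noerlund_kernel_def sum_distrib_left
    by (rule sum.cong) (use assms in \<open>auto simp: walsh_char_power2_add\<close>)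
  show ?thesis unfolding noerlund_kernel_def[of q \<sigma> "2 ^ m + k"] sum_lessThan_add head tail
    by simp
qed

text \<open>The block normalised to integral 2: a kernel concentrated near \<open>[0, 2\<^sup>-\<^sup>l)\<close> that dominates both
  the Dirichlet and the Fejer kernel of order \<open>2\<^sup>l\<close>.\<close>
definition fejer_bump :: "(nat \<Rightarrow> real) \<Rightarrow> nat \<Rightarrow> real" where
  "fejer_bump \<sigma> l = fejer_block \<sigma> l / 2 ^ l"

lemma fejer_bump_nonneg: "signs \<sigma> \<Longrightarrow> 0 \<le> fejer_bump \<sigma> l"
  by (simp add: fejer_bump_def fejer_block_nonneg)

lemma dirichlet_le_fejer_bump: "signs \<sigma> \<Longrightarrow> dirichlet \<sigma> (2 ^ l) \<le> fejer_bump \<sigma> l"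
  using fejer_sum_power2_nonneg[of \<sigma> l] by (simp add: fejer_bump_def fejer_block_def field_simps)

context
  fixes q :: "nat \<Rightarrow> real"
  assumes dec: "decseq q" and nonneg: "\<And>k. 0 \<le> q k"
begin

lemma weight_sum_mono: "m \<le> n \<Longrightarrow> weight_sum q m \<le> weight_sum q n"
  unfolding weight_sum_def by (rule sum_mono2) (auto simp: nonneg)

lemma weight_sum_nonneg: "0 \<le> weight_sum q n"
  unfolding weight_sum_def by (simp add: nonneg sum_nonneg)

lemma weight_sum_subadditive: "weight_sum q (m + n) \<le> weight_sum q m + weight_sum q n"
proof -
  have "(\<Sum>i<n. q (m + i)) \<le> (\<Sum>i<n. q i)"
    by (rule sum_mono) (simp add: decseqD[OF dec])
  then show ?thesis unfolding weight_sum_add by (simp add: weight_sum_def)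
qed

lemma weight_sum_double: "weight_sum q (2 * n) \<le> 2 * weight_sum q n"
  using weight_sum_subadditive[of n n] unfolding mult_2 .

lemma weight_le_weight_sum: "real n * q n \<le> weight_sum q n"
proof -
  have "(\<Sum>i<n. q n) \<le> (\<Sum>i<n. q i)"
    by (rule sum_mono) (simp add: decseqD[OF dec])
  then show ?thesis by (simp add: weight_sum_def)
qed

lemma abs_noerlund_error_le:
  assumes "signs \<sigma>"
  shows "\<bar>walsh_char \<sigma> a * (\<Sum>i = 1..2 ^ m - 1. q (k + i) * dirichlet \<sigma> i)\<bar>
    \<le> (\<Sum>l<m. q (k + 2 ^ l) * fejer_block \<sigma> l)"
  unfolding abs_mult abs_walsh_char[OF assms] mult_1
  by (rule abs_weighted_dirichlet_sum_le[OF assms]) (simp_all add: decseqD[OF dec] nonneg)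

text \<open>Unrolling the recursion over all digits: scale \<open>l\<close> can receive a contribution from each of the
  \<open>m - l\<close> possible digits above or at it, of size at most \<open>2 Q(2\<^sup>l)\<close> because
  \<open>Q(2\<^sup>l\<^sup>+\<^sup>1) \<le> 2 Q(2\<^sup>l)\<close> and \<open>2\<^sup>l q(2\<^sup>l) \<le> Q(2\<^sup>l)\<close>.\<close>
lemma abs_noerlund_kernel_le:
  assumes "signs \<sigma>" "n < 2 ^ m"
  shows "\<bar>noerlund_kernel q \<sigma> n\<bar> \<le> 2 * (\<Sum>l<m. real (m - l) * weight_sum q (2 ^ l) * fejer_bump \<sigma> l)"
  using assms(2)
proof (induction m arbitrary: n)
  case 0
  then show ?case by (simp add: noerlund_kernel_def)
next
  case (Suc m)
  let ?u = "\<lambda>l. weight_sum q (2 ^ l) * fejer_bump \<sigma> l"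
  have u: "0 \<le> ?u l" for l by (simp add: weight_sum_nonneg fejer_bump_nonneg assms)
  have step: "\<bar>noerlund_kernel q \<sigma> n\<bar> \<le> \<bar>noerlund_kernel q \<sigma> k\<bar> + 2 * (\<Sum>l<Suc m. ?u l)"
    if n: "n = 2 ^ m + k" and k: "k < 2 ^ m" for k
  proof -
    have s: "\<bar>\<sigma> m\<bar> = 1" by (rule signs_abs[OF assms(1)])
    have "\<bar>noerlund_kernel q \<sigma> n\<bar> \<le> \<bar>weight_sum q n * dirichlet \<sigma> (2 ^ m)\<bar> + \<bar>\<sigma> m * noerlund_kernel q \<sigma> k\<bar>
       + \<bar>walsh_char \<sigma> (2 ^ m - 1) * (\<Sum>i = 1..2 ^ m - 1. q (k + i) * dirichlet \<sigma> i)\<bar>"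
      unfolding n noerlund_kernel_power2_add[OF assms(1) k] by linarith
    also have "\<bar>weight_sum q n * dirichlet \<sigma> (2 ^ m)\<bar> \<le> 2 * ?u m"
    proof -
      have "weight_sum q n \<le> weight_sum q (2 * 2 ^ m)" by (rule weight_sum_mono) (use n k in simp)
      also have "\<dots> \<le> 2 * weight_sum q (2 ^ m)" by (rule weight_sum_double)
      finally show ?thesis
        using mult_mono[OF _ dirichlet_le_fejer_bump[OF assms(1), of m],
            of "weight_sum q n" "2 * weight_sum q (2 ^ m)"]
          dirichlet_power2_bounds(1)[OF assms(1), of m] weight_sum_nonneg by (simp add: abs_mult)
    qed
    also have "\<bar>\<sigma> m * noerlund_kernel q \<sigma> k\<bar> = \<bar>noerlund_kernel q \<sigma> k\<bar>" by (simp add: abs_mult s)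
    also have "\<bar>walsh_char \<sigma> (2 ^ m - 1) * (\<Sum>i = 1..2 ^ m - 1. q (k + i) * dirichlet \<sigma> i)\<bar>
        \<le> (\<Sum>l<m. q (k + 2 ^ l) * fejer_block \<sigma> l)"
      by (rule abs_noerlund_error_le[OF assms(1)])
    also have "\<dots> \<le> (\<Sum>l<m. ?u l)"
    proof (rule sum_mono)
      fix l
      have "q (k + 2 ^ l) * 2 ^ l \<le> q (2 ^ l) * 2 ^ l"
        by (intro mult_right_mono) (simp_all add: decseqD[OF dec])
      also have "\<dots> \<le> weight_sum q (2 ^ l)"
        using weight_le_weight_sum[of "2 ^ l"] by (simp add: mult.commute)
      finally have "q (k + 2 ^ l) * 2 ^ l * fejer_bump \<sigma> l \<le> ?u l"
        by (rule mult_right_mono) (rule fejer_bump_nonneg[OF assms(1)])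
      then show "q (k + 2 ^ l) * fejer_block \<sigma> l \<le> ?u l" by (simp add: fejer_bump_def)
    qed
    also have "\<dots> \<le> 2 * (\<Sum>l<m. ?u l)" using sum_nonneg[of "{..<m}" ?u] u by simp
    finally show ?thesis by (simp add: algebra_simps)
  qed
  have split: "(\<Sum>l<Suc m. real (Suc m - l) * weight_sum q (2 ^ l) * fejer_bump \<sigma> l)
      = (\<Sum>l<m. real (m - l) * weight_sum q (2 ^ l) * fejer_bump \<sigma> l) + (\<Sum>l<Suc m. ?u l)"
  proof -
    have "(\<Sum>l<m. real (Suc m - l) * weight_sum q (2 ^ l) * fejer_bump \<sigma> l)
        = (\<Sum>l<m. real (m - l) * weight_sum q (2 ^ l) * fejer_bump \<sigma> l + ?u l)"
      by (rule sum.cong) (auto simp: Suc_diff_le algebra_simps)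
    then show ?thesis by (simp add: sum.distrib)
  qed
  show ?case
  proof (cases "n < 2 ^ m")
    case True
    then show ?thesis unfolding split using Suc.IH[OF True] sum_nonneg[of "{..<Suc m}" ?u] u by simp
  next
    case False
    then obtain k where n: "n = 2 ^ m + k" by (metis le_add_diff_inverse not_less)
    with Suc.prems have k: "k < 2 ^ m" by simp
    show ?thesis unfolding split distrib_left
      by (rule order_trans[OF step[OF n k] add_right_mono[OF Suc.IH[OF k]]])
  qed
qed

end

section \<open>Integrals of the kernels\<close>

lemma borel_ident_unit [measurable]: "(\<lambda>x. x) \<in> borel_measurable unit_measure"
  by (rule borel_measurable_unit) simp

lemma kernel_measurable [measurable]:
  assumes [measurable]: "f \<in> borel_measurable M" "g \<in> borel_measurable M"
  shows "(\<lambda>z. walsh_char (dyadic_quotient (f z) (g z)) n) \<in> borel_measurable M"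
    and "(\<lambda>z. dirichlet (dyadic_quotient (f z) (g z)) n) \<in> borel_measurable M"
    and "(\<lambda>z. fejer_sum (dyadic_quotient (f z) (g z)) n) \<in> borel_measurable M"
    and "(\<lambda>z. fejer_bump (dyadic_quotient (f z) (g z)) n) \<in> borel_measurable M"
    and "(\<lambda>z. noerlund_kernel q (dyadic_quotient (f z) (g z)) n) \<in> borel_measurable M"
proof -
  show [measurable]: "(\<lambda>z. walsh_char (dyadic_quotient (f z) (g z)) n) \<in> borel_measurable M" for n
    unfolding walsh_char_dyadic_quotient by measurable
  show [measurable]: "(\<lambda>z. dirichlet (dyadic_quotient (f z) (g z)) n) \<in> borel_measurable M" for n
    unfolding dirichlet_def by measurable
  show [measurable]: "(\<lambda>z. fejer_sum (dyadic_quotient (f z) (g z)) n) \<in> borel_measurable M" for n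
    unfolding fejer_sum_def by measurable
  show "(\<lambda>z. fejer_bump (dyadic_quotient (f z) (g z)) n) \<in> borel_measurable M"
    unfolding fejer_bump_def fejer_block_def by measurable
  show "(\<lambda>z. noerlund_kernel q (dyadic_quotient (f z) (g z)) n) \<in> borel_measurable M"
    unfolding noerlund_kernel_def by measurable
qed

lemma walsh_char_square: "signs \<sigma> \<Longrightarrow> walsh_char \<sigma> i * walsh_char \<sigma> i = 1"
  by (metis abs_walsh_char abs_mult_self_eq mult_1)

lemma abs_sum_walsh_char_le:
  "signs \<sigma> \<Longrightarrow> \<bar>\<Sum>i<n. c i * walsh_char \<sigma> i\<bar> \<le> (\<Sum>i<n. \<bar>c i\<bar>)"
  by (rule order_trans[OF sum_abs]) (simp add: abs_mult abs_walsh_char)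

lemma integrable_walsh_char [simp]:
  "integrable unit_measure (\<lambda>t. walsh_char (dyadic_quotient x t) i)"
  by (rule integrable_bounded[where B = 1]) (simp_all add: abs_walsh_char signs_dyadic_quotient)

lemma integrable_walsh_char_mult [simp]:
  "integrable unit_measure (\<lambda>t. walsh_char (dyadic_quotient x t) i * walsh_char (dyadic_quotient x t) j)"
  by (rule integrable_bounded[where B = 1])
    (simp_all add: abs_mult abs_walsh_char signs_dyadic_quotient)

lemma integral_walsh_char_mult:
  "(LINT t|unit_measure. walsh_char (dyadic_quotient x t) i * walsh_char (dyadic_quotient x t) j)
    = (if i = j then 1 else 0)"
proof -
  have "(LINT t|unit_measure. walsh_char (dyadic_quotient x t) i * walsh_char (dyadic_quotient x t) j)
      = (LINT t|unit_measure. (walsh i x * walsh j x) * (walsh i t * walsh j t))"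
    by (simp add: walsh_char_dyadic_quotient mult_ac)
  also have "\<dots> = walsh i x * walsh j x * (if i = j then 1 else 0)"
    by (simp only: integral_mult_right_zero walsh_orthonormal)
  finally show ?thesis
    using walsh_char_square[OF signs_rademacher] by (simp add: walsh_eq_walsh_char)
qed

lemma integrable_dirichlet [simp]:
  "integrable unit_measure (\<lambda>t. dirichlet (dyadic_quotient x t) n)"
  unfolding dirichlet_def by simp

lemma integrable_dirichlet_mult [simp]:
  "integrable unit_measure (\<lambda>t. dirichlet (dyadic_quotient x t) m * dirichlet (dyadic_quotient x t) n)"
  unfolding dirichlet_def sum_product by simp

lemma integral_dirichlet_mult:
  "(LINT t|unit_measure. dirichlet (dyadic_quotient x t) m * dirichlet (dyadic_quotient x t) n)
    = real (min m n)"
proof -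
  have "(LINT t|unit_measure. dirichlet (dyadic_quotient x t) m * dirichlet (dyadic_quotient x t) n)
      = (\<Sum>i<m. \<Sum>j<n. if i = j then 1 else 0)"
    unfolding dirichlet_def sum_product
    by (simp add: Bochner_Integration.integral_sum integral_walsh_char_mult)
  also have "\<dots> = (\<Sum>i<m. if i < n then 1 else 0)" by (simp add: sum.delta)
  also have "\<dots> = real (card ({..<m} \<inter> {..<n}))"
    by (simp add: sum.If_cases lessThan_def[symmetric])
  also have "{..<m} \<inter> {..<n} = {..<min m n}" by auto
  finally show ?thesis by simp
qed

lemma integral_dirichlet:
  "(LINT t|unit_measure. dirichlet (dyadic_quotient x t) n) = (if n = 0 then 0 else 1)"
proof -
  have "dirichlet \<sigma> 1 = 1" for \<sigma> by (simp add: dirichlet_def)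
  then show ?thesis using integral_dirichlet_mult[of x n 1] by (auto simp: min_def)
qed

lemma integrable_fejer_sum [simp]:
  "integrable unit_measure (\<lambda>t. fejer_sum (dyadic_quotient x t) n)"
  unfolding fejer_sum_def by simp

lemma integral_fejer_sum:
  "(LINT t|unit_measure. fejer_sum (dyadic_quotient x t) n) = real n"
  unfolding fejer_sum_def by (simp add: Bochner_Integration.integral_sum integral_dirichlet)

lemma integrable_fejer_sum_mult [simp]:
  "integrable unit_measure (\<lambda>t. fejer_sum (dyadic_quotient x t) m * dirichlet (dyadic_quotient x t) n)"
  unfolding fejer_sum_def sum_distrib_right by simp

lemma integral_fejer_sum_mult:
  "(LINT t|unit_measure. fejer_sum (dyadic_quotient x t) m * dirichlet (dyadic_quotient x t) n)
    = (\<Sum>k = 1..m. real (min k n))"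
  unfolding fejer_sum_def sum_distrib_right
  by (simp add: Bochner_Integration.integral_sum integral_dirichlet_mult)

lemma integrable_fejer_bump [simp]:
  "integrable unit_measure (\<lambda>t. fejer_bump (dyadic_quotient x t) l)"
  unfolding fejer_bump_def fejer_block_def by simp

lemma integral_fejer_block:
  "(LINT t|unit_measure. fejer_block (dyadic_quotient x t) l) = 2 * 2 ^ l"
  unfolding fejer_block_def by (simp add: integral_fejer_sum integral_dirichlet)

lemma integrable_fejer_block [simp]:
  "integrable unit_measure (\<lambda>t. fejer_block (dyadic_quotient x t) l)"
  unfolding fejer_block_def by simp

lemma integral_fejer_bump:
  "(LINT t|unit_measure. fejer_bump (dyadic_quotient x t) l) = 2"
  unfolding fejer_bump_def by (simp add: integral_fejer_block)

lemma integrable_fejer_bump_mult [simp]: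
  "integrable unit_measure (\<lambda>t. fejer_bump (dyadic_quotient x t) l * dirichlet (dyadic_quotient x t) n)"
  unfolding fejer_bump_def fejer_block_def
  by (simp add: add_divide_distrib distrib_right mult.assoc)

text \<open>The indicator of the complement of the interval \<open>[0, 2\<^sup>-\<^sup>N)\<close>, written as a Walsh polynomial so
  that its products with kernels can be integrated by orthonormality.\<close>
definition off_interval :: "nat \<Rightarrow> (nat \<Rightarrow> real) \<Rightarrow> real" where
  "off_interval N \<sigma> = 1 - dirichlet \<sigma> (2 ^ N) / 2 ^ N"

lemma off_interval_eq:
  "signs \<sigma> \<Longrightarrow> off_interval N \<sigma> = (if \<forall>j<N. \<sigma> j = 1 then 0 else 1)"
  by (simp add: off_interval_def dirichlet_power2)

lemma off_interval_measurable [measurable]: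
  assumes [measurable]: "f \<in> borel_measurable M" "g \<in> borel_measurable M"
  shows "(\<lambda>z. off_interval N (dyadic_quotient (f z) (g z))) \<in> borel_measurable M"
  unfolding off_interval_def by measurable

text \<open>For \<open>l > N\<close> the mass outside \<open>[0, 2\<^sup>-\<^sup>N)\<close> is geometrically small: there \<open>D(2\<^sup>l)\<close> vanishes, and
  among \<open>D\<^sub>1, ..., D(2\<^sup>l)\<close> only those of index below \<open>2\<^sup>N\<close> have a nonzero integral there.\<close>
lemma integral_fejer_bump_off_interval:
  "(LINT t|unit_measure. fejer_bump (dyadic_quotient x t) l * off_interval N (dyadic_quotient x t))
    \<le> (if l \<le> N then 2 else 2 ^ N / 2 ^ l)"
proof -
  let ?\<sigma> = "dyadic_quotient x"
  have "(LINT t|unit_measure. fejer_bump (?\<sigma> t) l * off_interval N (?\<sigma> t))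
      = (LINT t|unit_measure. fejer_bump (?\<sigma> t) l
          - (fejer_bump (?\<sigma> t) l * dirichlet (?\<sigma> t) (2 ^ N)) / 2 ^ N)"
    by (simp add: off_interval_def algebra_simps)
  also have "\<dots> = 2 - (LINT t|unit_measure. fejer_bump (?\<sigma> t) l * dirichlet (?\<sigma> t) (2 ^ N)) / 2 ^ N"
    by (simp add: integral_fejer_bump)
  also have "(LINT t|unit_measure. fejer_bump (?\<sigma> t) l * dirichlet (?\<sigma> t) (2 ^ N))
      = (LINT t|unit_measure. fejer_sum (?\<sigma> t) (2 ^ l) * dirichlet (?\<sigma> t) (2 ^ N) / 2 ^ l
          + dirichlet (?\<sigma> t) (2 ^ l) * dirichlet (?\<sigma> t) (2 ^ N))"
    by (simp add: fejer_bump_def fejer_block_def add_divide_distrib distrib_right)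
  also have "\<dots> = (\<Sum>k = 1..2 ^ l. real (min k (2 ^ N))) / 2 ^ l + real (min (2 ^ l) (2 ^ N))"
    by (simp add: integral_fejer_sum_mult integral_dirichlet_mult)
  finally have val: "(LINT t|unit_measure. fejer_bump (?\<sigma> t) l * off_interval N (?\<sigma> t))
    = 2 - ((\<Sum>k = 1..2 ^ l. real (min k (2 ^ N))) / 2 ^ l + real (min (2 ^ l) (2 ^ N))) / 2 ^ N" .
  show ?thesis
  proof (cases "l \<le> N")
    case True
    then show ?thesis unfolding val by (auto intro!: divide_nonneg_nonneg add_nonneg_nonneg sum_nonneg)
  next
    case False
    then have le: "(2::nat) ^ N \<le> 2 ^ l" by simp
    have "real (2 ^ N * (2 ^ l - 2 ^ N)) = (\<Sum>k = 2 ^ N + 1..(2 ^ l :: nat). real (2 ^ N))"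
      by simp
    also have "\<dots> \<le> (\<Sum>k = 2 ^ N + 1..(2 ^ l :: nat). real (min k (2 ^ N)))" by (rule sum_mono) auto
    also have "\<dots> \<le> (\<Sum>k = 1..2 ^ l. real (min k (2 ^ N)))"
      by (rule sum_mono2) auto
    finally have "2 ^ N * (2 ^ l - 2 ^ N) \<le> (\<Sum>k = 1..2 ^ l. real (min k (2 ^ N)))"
      using le by (simp add: of_nat_diff)
    then have "2 ^ N * (2 ^ l - 2 ^ N) / (2 ^ l * 2 ^ N)
        \<le> (\<Sum>k = 1..2 ^ l. real (min k (2 ^ N))) / (2 ^ l * 2 ^ N)"
      by (rule divide_right_mono) simp
    moreover have "2 ^ N * (2 ^ l - 2 ^ N) / (2 ^ l * 2 ^ N) = 1 - 2 ^ N / (2 ^ l :: real)"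
      by (simp add: field_simps)
    moreover have "real (min (2 ^ l) (2 ^ N)) = 2 ^ N" using le by (simp add: min_def)
    ultimately show ?thesis unfolding val using False by (simp add: add_divide_distrib)
  qed
qed

section \<open>The means as integral operators\<close>

lemma sum_triangle_swap:
  fixes g :: "nat \<Rightarrow> nat \<Rightarrow> 'a::comm_monoid_add"
  shows "(\<Sum>m<n. \<Sum>k\<le>m. g m k) = (\<Sum>k<n. \<Sum>m = k..<n. g m k)"
proof (induction n)
  case (Suc n)
  have "(\<Sum>k<n. \<Sum>m = k..<Suc n. g m k) = (\<Sum>k<n. (\<Sum>m = k..<n. g m k) + g n k)"
    by (rule sum.cong) auto
  then show ?case using Suc by (simp add: sum.distrib lessThan_Suc_atMost[symmetric] add_ac)
qed simp

lemma noerlund_mean_eq_multiplier: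
  "noerlund_mean q n f x
    = (\<Sum>i<n. weight_sum q (n - i) * (walsh_coeff f i * walsh i x)) / weight_sum q n"
proof -
  let ?a = "\<lambda>i. walsh_coeff f i * walsh i x"
  have "(\<Sum>k = 1..n. q (n - k) * walsh_partial_sum k f x)
      = (\<Sum>m<n. \<Sum>i\<le>m. q (n - Suc m) * ?a i)"
    unfolding walsh_partial_sum_def sum_distrib_left
    by (simp add: sum.atLeast1_atMost_eq lessThan_Suc_atMost)
  also have "\<dots> = (\<Sum>i<n. (\<Sum>m = i..<n. q (n - Suc m)) * ?a i)"
    unfolding sum_triangle_swap by (simp add: sum_distrib_right)
  also have "\<dots> = (\<Sum>i<n. weight_sum q (n - i) * ?a i)"
  proof (rule sum.cong)
    fix i assume "i \<in> {..<n}"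
    then have "(\<Sum>m = i..<n. q (n - Suc m)) = weight_sum q (n - i)"
      unfolding weight_sum_def
      by (intro sum.reindex_bij_witness[of _ "\<lambda>k. n - Suc k" "\<lambda>m. n - Suc m"]) auto
    then show "(\<Sum>m = i..<n. q (n - Suc m)) * ?a i = weight_sum q (n - i) * ?a i" by simp
  qed simp
  finally show ?thesis by (simp add: noerlund_mean_def)
qed

lemma integrable_mult_bounded:
  fixes f g :: "real \<Rightarrow> real"
  assumes "integrable unit_measure f" "g \<in> borel_measurable unit_measure" "\<And>t. \<bar>g t\<bar> \<le> B"
  shows "integrable unit_measure (\<lambda>t. f t * g t)"
proof (rule Bochner_Integration.integrable_bound[of _ "\<lambda>t. B * f t"])
  have "\<bar>g t\<bar> \<le> \<bar>B\<bar>" for t using assms(3)[of t] by simp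
  then show "AE t in unit_measure. norm (f t * g t) \<le> norm (B * f t)"
    by (intro AE_I2) (simp add: abs_mult mult.commute[of "\<bar>B\<bar>"] mult_left_mono)
qed (use assms in auto)

lemma integrable_mult_walsh_char:
  assumes "integrable unit_measure f"
  shows "integrable unit_measure (\<lambda>t. f t * walsh_char (dyadic_quotient x t) i)"
  by (rule integrable_mult_bounded[OF assms, where B = 1])
    (simp_all add: abs_walsh_char signs_dyadic_quotient)

lemma walsh_multiplier_eq_integral:
  assumes "integrable unit_measure f"
  shows "(\<Sum>i<n. c i * (walsh_coeff f i * walsh i x))
    = (LINT t|unit_measure. f t * (\<Sum>i<n. c i * walsh_char (dyadic_quotient x t) i))"
proof -
  have "(LINT t|unit_measure. f t * (\<Sum>i<n. c i * walsh_char (dyadic_quotient x t) i))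
     = (\<Sum>i<n. LINT t|unit_measure. c i * (f t * walsh_char (dyadic_quotient x t) i))"
    unfolding sum_distrib_left
    by (subst Bochner_Integration.integral_sum[symmetric])
      (simp_all add: integrable_mult_walsh_char[OF assms] mult_ac)
  also have "\<dots> = (\<Sum>i<n. c i * (walsh_coeff f i * walsh i x))"
  proof (rule sum.cong)
    fix i
    have "(LINT t|unit_measure. c i * (f t * walsh_char (dyadic_quotient x t) i))
        = (LINT t|unit_measure. c i * walsh i x * (f t * walsh i t))"
      by (simp add: walsh_char_dyadic_quotient mult_ac)
    then show "(LINT t|unit_measure. c i * (f t * walsh_char (dyadic_quotient x t) i))
        = c i * (walsh_coeff f i * walsh i x)"
      unfolding walsh_coeff_def integral_mult_right_zero by (simp only: mult_ac)
  qed simp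
  finally show ?thesis by simp
qed

lemma noerlund_mean_eq_integral:
  assumes "integrable unit_measure f"
  shows "noerlund_mean q n f x
    = (LINT t|unit_measure. f t * noerlund_kernel q (dyadic_quotient x t) n) / weight_sum q n"
  unfolding noerlund_mean_eq_multiplier walsh_multiplier_eq_integral[OF assms]
  by (simp add: noerlund_kernel_def)

lemma walsh_partial_sum_measurable [measurable]:
  "walsh_partial_sum n f \<in> borel_measurable borel"
  unfolding walsh_partial_sum_def by measurable

lemma walsh_partial_sum_measurable_unit [measurable]:
  "walsh_partial_sum n f \<in> borel_measurable unit_measure"
  by (rule borel_measurable_unit) simp

lemma noerlund_mean_measurable [measurable]:
  "noerlund_mean q n f \<in> borel_measurable unit_measure"
  unfolding noerlund_mean_def by measurable

lemma noerlund_maximal_measurable [measurable]: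
  "noerlund_maximal q f \<in> borel_measurable unit_measure"
  unfolding noerlund_maximal_def by measurable

lemma dyadic_maximal_measurable [measurable]:
  "dyadic_maximal f \<in> borel_measurable unit_measure"
  unfolding dyadic_maximal_def by measurable

section \<open>Sufficiency of the growth condition for bounded functions\<close>

text \<open>The sums \<open>U\<^sub>m\<close> satisfy \<open>U\<^sub>m\<^sub>+\<^sub>1 - U\<^sub>m = u\<^sub>m\<^sub>+\<^sub>1 \<ge> U\<^sub>m\<^sub>+\<^sub>1 / B\<close>, so they grow geometrically, and \<open>u\<close> is
  comparable to \<open>U\<close>.\<close>
lemma geometric_growth_of_summable_growth:
  fixes u :: "nat \<Rightarrow> real"
  assumes "mono u" "\<And>k. 0 \<le> u k" "\<And>m. (\<Sum>k = 1..m. u k) \<le> C * u m"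
  obtains \<theta> B where "0 < \<theta>" "\<theta> < 1" "0 < B" "\<And>l m. l \<le> m \<Longrightarrow> u l \<le> B * \<theta> ^ (m - l) * u m"
proof -
  define B where "B = \<bar>C\<bar> + 2"
  define U where "U m = (\<Sum>k\<le>m. u k)" for m
  define \<theta> where "\<theta> = 1 - 1 / B"
  have B: "2 \<le> B" by (simp add: B_def)
  have U_le: "U m \<le> B * u m" for m
  proof -
    have "U m = u 0 + (\<Sum>k = 1..m. u k)"
      by (simp add: U_def atMost_atLeast0 sum.atLeast_Suc_atMost)
    also have "\<dots> \<le> u m + C * u m"
      using assms(3)[of m] monoD[OF assms(1), of 0 m] by simp
    also have "\<dots> \<le> B * u m"
      using mult_right_mono[of "1 + C" B "u m"] assms(2)[of m] by (simp add: B_def algebra_simps)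
    finally show ?thesis .
  qed
  have step: "U m \<le> \<theta> * U (Suc m)" for m
  proof -
    have "U (Suc m) / B \<le> u (Suc m)" using U_le[of "Suc m"] B by (simp add: field_simps)
    moreover have "U (Suc m) = U m + u (Suc m)" by (simp add: U_def)
    moreover have "\<theta> * U (Suc m) = U (Suc m) - U (Suc m) / B"
      by (simp add: \<theta>_def left_diff_distrib)
    ultimately show ?thesis by linarith
  qed
  have \<theta>: "0 < \<theta>" "\<theta> < 1" using B by (simp_all add: \<theta>_def)
  have iter: "U l \<le> \<theta> ^ j * U (l + j)" for l j
  proof (induction j)
    case (Suc j)
    also have "\<theta> ^ j * U (l + j) \<le> \<theta> ^ j * (\<theta> * U (l + Suc j))"
      using step[of "l + j"] \<theta> by (intro mult_left_mono) auto
    finally show ?case by (simp add: mult_ac)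
  qed simp
  have "u l \<le> B * \<theta> ^ (m - l) * u m" if "l \<le> m" for l m
  proof -
    have "u l \<le> U l" unfolding U_def by (rule member_le_sum) (use assms in auto)
    also have "\<dots> \<le> \<theta> ^ (m - l) * U m" using iter[of l "m - l"] that by simp
    also have "\<dots> \<le> \<theta> ^ (m - l) * (B * u m)" using U_le \<theta> by (intro mult_left_mono) auto
    finally show ?thesis by (simp add: mult_ac)
  qed
  then show ?thesis using that[of \<theta> B] \<theta> B by simp
qed

lemma linear_times_geometric_le_geometric:
  fixes \<theta> :: real
  assumes "0 < \<theta>" "\<theta> < 1"
  obtains \<kappa> B where "0 < \<kappa>" "\<kappa> < 1" "0 < B" "\<And>r. real (Suc r) * \<theta> ^ r \<le> B * \<kappa> ^ r"
proof -
  define \<kappa> where "\<kappa> = (1 + \<theta>) / 2"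
  define \<rho> where "\<rho> = \<theta> / \<kappa>"
  have \<kappa>: "0 < \<kappa>" "\<kappa> < 1" "\<theta> < \<kappa>" using assms by (simp_all add: \<kappa>_def)
  have \<rho>: "0 < \<rho>" "\<rho> < 1" using \<kappa> assms by (simp_all add: \<rho>_def)
  have "(\<lambda>r. real r * \<rho> ^ r + \<rho> ^ r) \<longlonglongrightarrow> 0 + 0"
    using \<rho> by (intro tendsto_add powser_times_n_limit_0 LIMSEQ_power_zero) auto
  then have "Bseq (\<lambda>r. real (Suc r) * \<rho> ^ r)"
    by (intro convergent_imp_Bseq convergentI) (simp add: algebra_simps)
  then obtain B where B: "0 < B" "\<And>r. \<bar>real (Suc r) * \<rho> ^ r\<bar> \<le> B"
    by (auto simp: Bseq_def)
  have "real (Suc r) * \<theta> ^ r \<le> B * \<kappa> ^ r" for r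
  proof -
    have "real (Suc r) * \<rho> ^ r * \<kappa> ^ r \<le> B * \<kappa> ^ r"
      using B(2)[of r] \<kappa> by (intro mult_right_mono) auto
    moreover have "\<rho> ^ r * \<kappa> ^ r = \<theta> ^ r" using \<kappa> by (simp add: \<rho>_def power_divide)
    ultimately show ?thesis by (simp add: mult.assoc)
  qed
  then show ?thesis using that \<kappa> B by blast
qed

definition bump_majorant :: "real \<Rightarrow> nat \<Rightarrow> (nat \<Rightarrow> real) \<Rightarrow> real" where
  "bump_majorant \<kappa> m \<sigma> = (\<Sum>l\<le>m. \<kappa> ^ (m - l) * fejer_bump \<sigma> l)"

lemma bump_majorant_nonneg: "signs \<sigma> \<Longrightarrow> 0 \<le> \<kappa> \<Longrightarrow> 0 \<le> bump_majorant \<kappa> m \<sigma>"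
  unfolding bump_majorant_def by (intro sum_nonneg mult_nonneg_nonneg fejer_bump_nonneg) auto

lemma bump_majorant_measurable [measurable]:
  assumes [measurable]: "f \<in> borel_measurable M" "g \<in> borel_measurable M"
  shows "(\<lambda>z. bump_majorant \<kappa> m (dyadic_quotient (f z) (g z))) \<in> borel_measurable M"
  unfolding bump_majorant_def by measurable

text \<open>The geometric decay of \<open>Q(2\<^sup>l) / Q(2\<^sup>m)\<close> absorbs the linear factor \<open>m + 1 - l\<close> of
  \<open>abs_noerlund_kernel_le\<close>. The majorant depends on \<open>n\<close> only through its top bit, which is what
  the maximal operator requires.\<close>
lemma noerlund_kernel_majorant:
  assumes "decseq q" "\<And>k. 0 \<le> q k"
    and "\<And>m. (\<Sum>k = 1..m. weight_sum q (2 ^ k)) \<le> C * weight_sum q (2 ^ m)"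
  obtains \<kappa> B where "0 < \<kappa>" "\<kappa> < 1" "0 < B"
    "\<And>\<sigma> m n. signs \<sigma> \<Longrightarrow> 2 ^ m \<le> n \<Longrightarrow> n < 2 ^ Suc m \<Longrightarrow>
      \<bar>noerlund_kernel q \<sigma> n\<bar> \<le> weight_sum q n * (B * bump_majorant \<kappa> m \<sigma>)"
proof -
  have "mono (\<lambda>k. weight_sum q (2 ^ k))"
    by (intro monoI weight_sum_mono assms) auto
  then obtain \<theta> B1 where \<theta>: "0 < \<theta>" "\<theta> < 1" "0 < B1"
    and g: "\<And>l m. l \<le> m \<Longrightarrow> weight_sum q (2 ^ l) \<le> B1 * \<theta> ^ (m - l) * weight_sum q (2 ^ m)"
    using geometric_growth_of_summable_growth[of "\<lambda>k. weight_sum q (2 ^ k)"] assms weight_sum_nonneg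
    by metis
  obtain \<kappa> B2 where \<kappa>: "0 < \<kappa>" "\<kappa> < 1" "0 < B2"
    and lin: "\<And>r. real (Suc r) * \<theta> ^ r \<le> B2 * \<kappa> ^ r"
    using linear_times_geometric_le_geometric[OF \<theta>(1,2)] by metis
  have "\<bar>noerlund_kernel q \<sigma> n\<bar> \<le> weight_sum q n * (2 * B1 * B2 * bump_majorant \<kappa> m \<sigma>)"
    if \<sigma>: "signs \<sigma>" and n: "2 ^ m \<le> n" "n < 2 ^ Suc m" for \<sigma> m n
  proof -
    have "\<bar>noerlund_kernel q \<sigma> n\<bar>
        \<le> 2 * (\<Sum>l<Suc m. real (Suc m - l) * weight_sum q (2 ^ l) * fejer_bump \<sigma> l)"
      by (rule abs_noerlund_kernel_le[OF assms(1,2) \<sigma> n(2)])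
    also have "\<dots> \<le> 2 * (\<Sum>l<Suc m. B1 * B2 * weight_sum q n * (\<kappa> ^ (m - l) * fejer_bump \<sigma> l))"
    proof (intro mult_left_mono sum_mono)
      fix l assume "l \<in> {..<Suc m}"
      then have l: "l \<le> m" by simp
      have "weight_sum q (2 ^ m) \<le> weight_sum q n" by (rule weight_sum_mono[OF assms(1,2) n(1)])
      then have "B1 * \<theta> ^ (m - l) * weight_sum q (2 ^ m) \<le> B1 * \<theta> ^ (m - l) * weight_sum q n"
        using \<theta> by (intro mult_left_mono) auto
      with g[OF l] have "weight_sum q (2 ^ l) \<le> B1 * \<theta> ^ (m - l) * weight_sum q n" by linarith
      then have "real (Suc m - l) * weight_sum q (2 ^ l)
          \<le> real (Suc (m - l)) * (B1 * \<theta> ^ (m - l) * weight_sum q n)"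
        using l by (simp only: Suc_diff_le) (intro mult_left_mono, auto)
      also have "\<dots> = B1 * weight_sum q n * (real (Suc (m - l)) * \<theta> ^ (m - l))"
        by (simp only: mult_ac)
      also have "\<dots> \<le> B1 * weight_sum q n * (B2 * \<kappa> ^ (m - l))"
        using lin[of "m - l"] \<theta> weight_sum_nonneg[OF assms(1,2), of n] by (intro mult_left_mono) auto
      finally have "real (Suc m - l) * weight_sum q (2 ^ l) * fejer_bump \<sigma> l
          \<le> B1 * weight_sum q n * (B2 * \<kappa> ^ (m - l)) * fejer_bump \<sigma> l"
        by (rule mult_right_mono) (rule fejer_bump_nonneg[OF \<sigma>])
      then show "real (Suc m - l) * weight_sum q (2 ^ l) * fejer_bump \<sigma> l
          \<le> B1 * B2 * weight_sum q n * (\<kappa> ^ (m - l) * fejer_bump \<sigma> l)"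
        by (simp only: mult_ac)
    qed simp
    also have "\<dots> = weight_sum q n * (2 * B1 * B2 * bump_majorant \<kappa> m \<sigma>)"
      unfolding bump_majorant_def lessThan_Suc_atMost sum_distrib_left by (simp only: mult_ac)
    finally show ?thesis .
  qed
  then show ?thesis using that[of \<kappa> "2 * B1 * B2"] \<kappa> \<theta> by simp
qed

lemma geometric_sum_le:
  fixes \<kappa> :: real
  assumes "0 < \<kappa>" "\<kappa> < 1"
  shows "(\<Sum>l\<le>m. \<kappa> ^ (m - l)) \<le> 1 / (1 - \<kappa>)"
proof -
  have "(\<Sum>l\<le>m. \<kappa> ^ (m - l)) = (\<Sum>l\<le>m. \<kappa> ^ l)"
    by (rule sum.reindex_bij_witness[of _ "\<lambda>l. m - l" "\<lambda>l. m - l"]) auto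
  also have "\<dots> = (1 - \<kappa> ^ Suc m) / (1 - \<kappa>)"
    using assms sum_gp_basic[of \<kappa> m] by (simp add: field_simps)
  also have "\<dots> \<le> 1 / (1 - \<kappa>)" using assms by (intro divide_right_mono) auto
  finally show ?thesis .
qed

lemma integrable_bump_majorant [simp]:
  "integrable unit_measure (\<lambda>t. bump_majorant \<kappa> m (dyadic_quotient x t))"
  unfolding bump_majorant_def by simp

lemma integral_bump_majorant_le:
  assumes "0 < \<kappa>" "\<kappa> < 1"
  shows "(LINT t|unit_measure. bump_majorant \<kappa> m (dyadic_quotient x t)) \<le> 2 / (1 - \<kappa>)"
proof -
  have "(LINT t|unit_measure. bump_majorant \<kappa> m (dyadic_quotient x t)) = (\<Sum>l\<le>m. \<kappa> ^ (m - l)) * 2"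
    unfolding bump_majorant_def
    by (simp add: Bochner_Integration.integral_sum integral_fejer_bump sum_distrib_right)
  then show ?thesis using geometric_sum_le[OF assms, of m] by simp
qed

lemma ex_dyadic_block:
  assumes "1 \<le> (n::nat)"
  obtains m where "2 ^ m \<le> n" "n < 2 ^ Suc m"
  using ex_power_ivl1[of 2 n] assms that by auto

lemma integrable_noerlund_kernel [simp]:
  "integrable unit_measure (\<lambda>t. noerlund_kernel q (dyadic_quotient x t) n)"
  unfolding noerlund_kernel_def by simp

lemma Linf_bounded_of_growth:
  assumes "decseq q" "\<And>k. 0 \<le> q k" "0 < q 0"
    and "\<And>m. (\<Sum>k = 1..m. weight_sum q (2 ^ k)) \<le> C * weight_sum q (2 ^ m)"
  shows "bounded_between Linf_space (\<lambda>f. Linf_norm (\<lambda>x. ennreal \<bar>f x\<bar>)) Linf_norm (noerlund_maximal q)"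
proof -
  obtain \<kappa> B where \<kappa>: "0 < \<kappa>" "\<kappa> < 1" "0 < B"
    and maj: "\<And>\<sigma> m n. signs \<sigma> \<Longrightarrow> 2 ^ m \<le> n \<Longrightarrow> n < 2 ^ Suc m \<Longrightarrow>
      \<bar>noerlund_kernel q \<sigma> n\<bar> \<le> weight_sum q n * (B * bump_majorant \<kappa> m \<sigma>)"
    using noerlund_kernel_majorant[OF assms(1,2,4)] by metis
  define c where "c = B * (2 / (1 - \<kappa>))"
  have "Linf_norm (noerlund_maximal q f) \<le> ennreal c * Linf_norm (\<lambda>x. ennreal \<bar>f x\<bar>)"
    if f: "f \<in> Linf_space" for f
  proof -
    define r where "r = enn2real (Linf_norm (\<lambda>x. ennreal \<bar>f x\<bar>))"
    have [measurable]: "f \<in> borel_measurable unit_measure" using f by (simp add: Linf_space_def)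
    have r: "ennreal r = Linf_norm (\<lambda>x. ennreal \<bar>f x\<bar>)" "0 \<le> r"
      using f by (auto simp: r_def Linf_space_def)
    have "AE t in unit_measure. ennreal \<bar>f t\<bar> \<le> ennreal r"
      unfolding r Linf_norm_def by (rule esssup_AE)
    then have bd: "AE t in unit_measure. \<bar>f t\<bar> \<le> r"
      using r(2) by (simp add: ennreal_le_iff)
    then have int_f: "integrable unit_measure f"
      by (intro unit.integrable_const_bound[where B = r]) auto
    have "\<bar>noerlund_mean q n f x\<bar> \<le> r * c" if n: "1 \<le> n" for n x
    proof -
      obtain m where m: "2 ^ m \<le> n" "n < 2 ^ Suc m" using ex_dyadic_block[OF n] .
      let ?K = "\<lambda>t. noerlund_kernel q (dyadic_quotient x t) n"
      let ?\<Psi> = "\<lambda>t. bump_majorant \<kappa> m (dyadic_quotient x t)"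
      have "weight_sum q 1 \<le> weight_sum q n" by (rule weight_sum_mono[OF assms(1,2) n])
      then have Q: "0 < weight_sum q n" using assms(3) by (simp add: weight_sum_def)
      have "\<bar>LINT t|unit_measure. f t * ?K t\<bar> \<le> (LINT t|unit_measure. r * (weight_sum q n * (B * ?\<Psi> t)))"
      proof (rule integral_abs_bound[THEN order_trans], rule integral_mono_AE')
        show "AE t in unit_measure. \<bar>f t * ?K t\<bar> \<le> r * (weight_sum q n * (B * ?\<Psi> t))"
          using bd by eventually_elim
            (use maj[OF signs_dyadic_quotient m] r(2) in \<open>auto simp: abs_mult intro!: mult_mono\<close>)
      qed (use Q r(2) \<kappa> in \<open>auto intro!: AE_I2 mult_nonneg_nonneg bump_majorant_nonneg signs_dyadic_quotient\<close>)
      also have "\<dots> = weight_sum q n * (r * (B * (LINT t|unit_measure. ?\<Psi> t)))" by simp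
      also have "\<dots> \<le> weight_sum q n * (r * (B * (2 / (1 - \<kappa>))))"
        using integral_bump_majorant_le[OF \<kappa>(1,2)] Q r(2) \<kappa>(3) by (intro mult_left_mono) auto
      finally show ?thesis
        using Q unfolding noerlund_mean_eq_integral[OF int_f] by (simp add: c_def field_simps)
    qed
    then have "noerlund_maximal q f x \<le> ennreal (r * c)" for x
      unfolding noerlund_maximal_def by (intro SUP_least ennreal_leI) auto
    then have "Linf_norm (noerlund_maximal q f) \<le> ennreal (r * c)"
      unfolding Linf_norm_def by (intro esssup_I) auto
    also have "\<dots> = ennreal c * ennreal r"
      using r(2) \<kappa> by (subst ennreal_mult[symmetric]) (auto simp: c_def mult.commute)
    finally show ?thesis by (simp add: r)
  qed
  then show ?thesis unfolding bounded_between_def by blast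
qed

section \<open>Sufficiency of the growth condition on the dyadic Hardy space\<close>

lemma dyadic_quotient_commute: "dyadic_quotient x t = dyadic_quotient t x"
  by (simp add: dyadic_quotient_def fun_eq_iff mult.commute)

lemma walsh_locally_constant:
  assumes "\<forall>j<k. dyadic_quotient x t j = 1" "i < 2 ^ k"
  shows "walsh i x = walsh i t"
proof -
  have "walsh_char (dyadic_quotient x t) i = 1"
    unfolding walsh_char_def
    by (intro prod.neutral) (use assms(1) bit_imp_less[OF _ assms(2)] in auto)
  then have "walsh i x * walsh i t = 1" by (simp add: walsh_char_dyadic_quotient)
  moreover have "walsh i t * walsh i t = 1"
    by (simp add: walsh_eq_walsh_char walsh_char_square signs_rademacher)
  ultimately show ?thesis by (metis mult.assoc mult.commute mult_1)
qed

primrec running_max :: "(real \<Rightarrow> real) \<Rightarrow> nat \<Rightarrow> real \<Rightarrow> real" where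
  "running_max f 0 x = \<bar>walsh_partial_sum (2 ^ 0) f x\<bar>"
| "running_max f (Suc k) x = max (running_max f k x) \<bar>walsh_partial_sum (2 ^ Suc k) f x\<bar>"

lemma abs_partial_sum_le_running_max: "\<bar>walsh_partial_sum (2 ^ k) f x\<bar> \<le> running_max f k x"
  by (cases k) auto

lemma running_max_nonneg: "0 \<le> running_max f k x"
  by (rule order_trans[OF abs_ge_zero abs_partial_sum_le_running_max])

lemma running_max_mono: "running_max f k x \<le> running_max f (Suc k) x"
  by simp

lemma running_max_le_dyadic_maximal: "ennreal (running_max f k x) \<le> dyadic_maximal f x"
proof (induction k)
  case 0
  show ?case unfolding dyadic_maximal_def by (rule SUP_upper2[of 0]) simp_all
next
  case (Suc k)
  have "ennreal \<bar>walsh_partial_sum (2 ^ Suc k) f x\<bar> \<le> dyadic_maximal f x"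
    unfolding dyadic_maximal_def by (rule SUP_upper) simp
  then show ?case using Suc by (auto simp: max_def)
qed

lemma running_max_measurable [measurable]: "running_max f k \<in> borel_measurable borel"
proof (induction k)
  case 0
  show ?case unfolding running_max.simps by measurable
next
  case (Suc k)
  note this [measurable]
  show ?case unfolding running_max.simps by measurable
qed

lemma running_max_locally_constant:
  "\<forall>j<k. dyadic_quotient x t j = 1 \<Longrightarrow> running_max f k x = running_max f k t"
proof (induction k)
  case 0
  then show ?case using walsh_locally_constant[of 0 x t 0] by (simp add: walsh_partial_sum_def)
next
  case (Suc k)
  have "walsh_partial_sum (2 ^ Suc k) f x = walsh_partial_sum (2 ^ Suc k) f t"
    unfolding walsh_partial_sum_def using walsh_locally_constant[OF Suc.prems] by simp
  then show ?case using Suc by simp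
qed

lemma off_interval_nonneg: "signs \<sigma> \<Longrightarrow> 0 \<le> off_interval N \<sigma>"
  by (simp add: off_interval_eq)

text \<open>An increment \<open>M\<^sub>k\<^sub>+\<^sub>1 - M\<^sub>k\<close> takes the same value at \<open>t\<close> and \<open>x\<close> if they share a dyadic interval of
  length \<open>2\<^sup>-\<^sup>k\<^sup>-\<^sup>1\<close>; only the other increments can raise the running maximum at \<open>t\<close> above the one
  at \<open>x\<close>.\<close>
lemma running_max_telescope:
  "running_max f m t \<le> running_max f m x
    + (\<Sum>k<m. (running_max f (Suc k) t - running_max f k t) * off_interval (Suc k) (dyadic_quotient x t))"
proof (induction m)
  case 0
  show ?case using running_max_locally_constant[of 0 x t f] by simp
next
  case (Suc m)
  let ?g = "\<lambda>k. (running_max f (Suc k) t - running_max f k t) * off_interval (Suc k) (dyadic_quotient x t)"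
  have g: "0 \<le> ?g k" for k
    using running_max_mono[of f k t] off_interval_nonneg[OF signs_dyadic_quotient] by simp
  show ?case
  proof (cases "\<forall>j<Suc m. dyadic_quotient x t j = 1")
    case True
    have "0 \<le> (\<Sum>k<Suc m. ?g k)" by (rule sum_nonneg) (rule g)
    then show ?thesis unfolding running_max_locally_constant[OF True, of f] by simp
  next
    case False
    then have "off_interval (Suc m) (dyadic_quotient x t) = 1"
      by (auto simp: off_interval_eq signs_dyadic_quotient)
    then have "?g m = running_max f (Suc m) t - running_max f m t" by (simp only: mult_1_right)
    then show ?thesis using Suc running_max_mono[of f m x] unfolding sum.lessThan_Suc by linarith
  qed
qed

lemma walsh_coeff_polynomial:
  "walsh_coeff (\<lambda>x. \<Sum>j<M. a j * walsh j x) i = (if i < M then a i else 0)"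
proof -
  have int: "integrable unit_measure (\<lambda>t. walsh j t * walsh i t)" for j
    by (rule integrable_bounded[where B = 1]) (auto intro: borel_measurable_unit simp: abs_mult abs_walsh)
  have "walsh_coeff (\<lambda>x. \<Sum>j<M. a j * walsh j x) i
      = (LINT t|unit_measure. (\<Sum>j<M. a j * (walsh j t * walsh i t)))"
    by (simp add: walsh_coeff_def sum_distrib_right mult.assoc)
  also have "\<dots> = (\<Sum>j<M. a j * (if j = i then 1 else 0))"
    using int by (simp add: Bochner_Integration.integral_sum walsh_orthonormal)
  also have "\<dots> = (if i < M then a i else 0)"
    by (simp add: sum.delta if_distrib cong: if_cong)
  finally show ?thesis .
qed

lemma walsh_coeff_partial_sum:
  "walsh_coeff (walsh_partial_sum M f) i = (if i < M then walsh_coeff f i else 0)"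
  unfolding walsh_partial_sum_def by (rule walsh_coeff_polynomial)

lemma integrable_partial_sum: "integrable unit_measure (walsh_partial_sum M f)"
proof (rule integrable_bounded)
  show "\<bar>walsh_partial_sum M f x\<bar> \<le> (\<Sum>i<M. \<bar>walsh_coeff f i\<bar>)" for x
    unfolding walsh_partial_sum_def walsh_eq_walsh_char
    by (rule abs_sum_walsh_char_le[OF signs_rademacher])
qed measurable

lemma noerlund_mean_partial_sum:
  assumes "n \<le> M"
  shows "noerlund_mean q n (walsh_partial_sum M f) x = noerlund_mean q n f x"
  unfolding noerlund_mean_eq_multiplier walsh_coeff_partial_sum using assms
  by (intro arg_cong2[where f = "(/)"] sum.cong) auto

text \<open>The convolution \<open>s\<close> satisfies \<open>s\<^sub>m\<^sub>+\<^sub>1 = \<kappa> s\<^sub>m + g\<^sub>m\<^sub>+\<^sub>1\<close>, so summing over \<open>m \<ge> k\<close> bounds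
  \<open>(1 - \<kappa>) (s\<^sub>k + s\<^sub>k\<^sub>+\<^sub>1 + ...)\<close> by \<open>s\<^sub>k + (g\<^sub>k\<^sub>+\<^sub>1 + g\<^sub>k\<^sub>+\<^sub>2 + ...)\<close>.\<close>
lemma sum_geometric_convolution_le:
  fixes \<kappa> :: real and g :: "nat \<Rightarrow> real"
  assumes "0 < \<kappa>" "\<kappa> < 1" and g: "\<And>l. 0 \<le> g l" "\<And>l. g l \<le> 2" "\<And>j. g (k + j) \<le> 4 / 2 ^ j"
  shows "(\<Sum>m = k..<n. \<Sum>l\<le>m. \<kappa> ^ (m - l) * g l) \<le> 10 / (1 - \<kappa>) ^ 2"
proof -
  define s where "s m = (\<Sum>l\<le>m. \<kappa> ^ (m - l) * g l)" for m
  have s_nonneg: "0 \<le> s m" for m unfolding s_def using assms by (intro sum_nonneg) auto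
  have s_Suc: "s (Suc m) = \<kappa> * s m + g (Suc m)" for m
  proof -
    have "(\<Sum>l\<le>m. \<kappa> ^ (Suc m - l) * g l) = (\<Sum>l\<le>m. \<kappa> * (\<kappa> ^ (m - l) * g l))"
      by (rule sum.cong) (auto simp: Suc_diff_le)
    then show ?thesis by (simp add: s_def sum_distrib_left)
  qed
  have s_k: "s k \<le> 2 / (1 - \<kappa>)"
  proof -
    have "s k \<le> (\<Sum>l\<le>k. \<kappa> ^ (k - l) * 2)"
      unfolding s_def using assms by (intro sum_mono mult_left_mono) auto
    also have "\<dots> = (\<Sum>l\<le>k. \<kappa> ^ (k - l)) * 2" by (simp add: sum_distrib_right)
    finally show ?thesis using geometric_sum_le[OF assms(1,2), of k] by simp
  qed
  \<comment> \<open>The terms in \<open>2\<^sup>j\<close> carry the geometric bound on \<open>g\<close> through the induction.\<close>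
  have pot: "(1 - \<kappa>) * (\<Sum>m = k..<k + j. s m) \<le> s k + 8 - 8 / 2 ^ j - s (k + j) + 4 / 2 ^ j" for j
  proof (induction j)
    case 0
    show ?case by simp
  next
    case (Suc j)
    have "(1 - \<kappa>) * s (k + j) = s (k + j) - s (k + Suc j) + g (k + Suc j)"
      using s_Suc[of "k + j"] by (simp add: algebra_simps)
    moreover have "g (k + Suc j) \<le> 4 / 2 ^ Suc j" by (rule g(3))
    moreover have "(\<Sum>m = k..<k + Suc j. s m) = (\<Sum>m = k..<k + j. s m) + s (k + j)" by simp
    moreover have "(8::real) / 2 ^ j = 16 / 2 ^ Suc j" "(4::real) / 2 ^ j = 8 / 2 ^ Suc j" by simp_all
    ultimately show ?case using Suc by (simp only: distrib_left)
  qed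
  have le: "(1 - \<kappa>) * (\<Sum>m = k..<n. s m) \<le> 2 / (1 - \<kappa>) + 8"
  proof (cases "k \<le> n")
    case True
    have "4 / 2 ^ (n - k) \<le> (8::real) / 2 ^ (n - k)" by (rule divide_right_mono) auto
    then show ?thesis using pot[of "n - k"] True s_nonneg[of n] s_k by simp
  next
    case False
    then show ?thesis using assms by simp
  qed
  also have "\<dots> \<le> 10 / (1 - \<kappa>)" using assms by (simp add: field_simps)
  finally have "(\<Sum>m = k..<n. s m) \<le> 10 / (1 - \<kappa>) / (1 - \<kappa>)"
    using assms(2) by (subst pos_le_divide_eq) (simp_all only: mult.commute diff_gt_0_iff_gt)
  then show ?thesis by (simp add: s_def power2_eq_square)
qed

text \<open>The bound on the mass of \<open>bump_majorant \<kappa> m\<close> outside \<open>[0, 2\<^sup>-\<^sup>N)\<close> that results from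
  \<open>integral_fejer_bump_off_interval\<close>.\<close>
definition off_mass :: "real \<Rightarrow> nat \<Rightarrow> nat \<Rightarrow> real" where
  "off_mass \<kappa> m N = (\<Sum>l\<le>m. \<kappa> ^ (m - l) * (if l \<le> N then 2 else 2 ^ N / 2 ^ l))"

text \<open>The uniformity in \<open>k\<close> lets the supremum over the scale \<open>m\<close> in the maximal operator be replaced
  by a sum.\<close>
lemma sum_off_mass_le:
  assumes "0 < \<kappa>" "\<kappa> < 1"
  shows "(\<Sum>m = k..<n. off_mass \<kappa> m (Suc k)) \<le> 10 / (1 - \<kappa>) ^ 2"
  unfolding off_mass_def
proof (rule sum_geometric_convolution_le[OF assms])
  fix l :: nat
  show "(if l \<le> Suc k then 2 else 2 ^ Suc k / 2 ^ l) \<le> (2::real)"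
    using power_increasing[of "Suc k" l "2::real"] by (auto simp: field_simps)
next
  fix j :: nat
  have "(2::real) ^ j \<le> 2 ^ 1" if "j \<le> 1" by (rule power_increasing) (use that in auto)
  then show "(if k + j \<le> Suc k then 2 else 2 ^ Suc k / 2 ^ (k + j)) \<le> (4::real) / 2 ^ j"
    by (auto simp: power_add field_simps)
qed auto

lemma integrable_bump_off_interval [simp]:
  "integrable unit_measure (\<lambda>t. fejer_bump (dyadic_quotient x t) l * off_interval N (dyadic_quotient x t))"
proof -
  have "integrable unit_measure (\<lambda>t. fejer_bump (dyadic_quotient x t) l
      - fejer_bump (dyadic_quotient x t) l * dirichlet (dyadic_quotient x t) (2 ^ N) / 2 ^ N)"
    by simp
  then show ?thesis by (simp add: off_interval_def algebra_simps)
qed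

lemma nn_integral_bump_majorant_off_interval:
  assumes "0 < \<kappa>"
  shows "(\<integral>\<^sup>+ t. ennreal (off_interval N (dyadic_quotient x t) * bump_majorant \<kappa> m (dyadic_quotient x t))
      \<partial>unit_measure) \<le> ennreal (off_mass \<kappa> m N)"
proof -
  let ?\<sigma> = "dyadic_quotient x"
  have eq: "off_interval N (?\<sigma> t) * bump_majorant \<kappa> m (?\<sigma> t)
      = (\<Sum>l\<le>m. \<kappa> ^ (m - l) * (fejer_bump (?\<sigma> t) l * off_interval N (?\<sigma> t)))" for t
    by (simp add: bump_majorant_def sum_distrib_left mult_ac)
  have "(\<integral>\<^sup>+ t. ennreal (off_interval N (?\<sigma> t) * bump_majorant \<kappa> m (?\<sigma> t)) \<partial>unit_measure)
      = ennreal (LINT t|unit_measure. off_interval N (?\<sigma> t) * bump_majorant \<kappa> m (?\<sigma> t))"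
  proof (rule nn_integral_eq_integral)
    show "integrable unit_measure (\<lambda>t. off_interval N (?\<sigma> t) * bump_majorant \<kappa> m (?\<sigma> t))"
      unfolding eq by simp
  qed (use assms in \<open>auto intro!: mult_nonneg_nonneg off_interval_nonneg bump_majorant_nonneg signs_dyadic_quotient\<close>)
  also have "(LINT t|unit_measure. off_interval N (?\<sigma> t) * bump_majorant \<kappa> m (?\<sigma> t))
      = (\<Sum>l\<le>m. \<kappa> ^ (m - l) * (LINT t|unit_measure. fejer_bump (?\<sigma> t) l * off_interval N (?\<sigma> t)))"
    unfolding eq by (simp add: Bochner_Integration.integral_sum)
  also have "\<dots> \<le> off_mass \<kappa> m N"
    unfolding off_mass_def using assms
    by (intro sum_mono mult_left_mono integral_fejer_bump_off_interval) auto
  finally show ?thesis by (simp add: ennreal_leI)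
qed

lemma ennreal_norm_integral_le:
  "ennreal (norm (integral\<^sup>L M f)) \<le> (\<integral>\<^sup>+ x. ennreal (norm (f x)) \<partial>M)"
  by (cases "integrable M f") (simp_all add: integral_norm_bound_ennreal not_integrable_integral_eq)

text \<open>The maximal function is split as in \<open>running_max_telescope\<close>. The part at \<open>x\<close> is at most
  \<open>c\<close> times the dyadic maximal function; in the part \<open>h m\<close> with the increments, integrating first
  over \<open>x\<close> leaves \<open>off_mass\<close> times the integral of each increment.\<close>
lemma H1_bounded_of_growth:
  assumes "decseq q" "\<And>k. 0 \<le> q k" "0 < q 0"
    and "\<And>m. (\<Sum>k = 1..m. weight_sum q (2 ^ k)) \<le> C * weight_sum q (2 ^ m)"
  shows "bounded_between H1_space H1_norm L1_norm (noerlund_maximal q)"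
proof -
  obtain \<kappa> B where \<kappa>: "0 < \<kappa>" "\<kappa> < 1" "0 < B"
    and maj: "\<And>\<sigma> m n. signs \<sigma> \<Longrightarrow> 2 ^ m \<le> n \<Longrightarrow> n < 2 ^ Suc m \<Longrightarrow>
      \<bar>noerlund_kernel q \<sigma> n\<bar> \<le> weight_sum q n * (B * bump_majorant \<kappa> m \<sigma>)"
    using noerlund_kernel_majorant[OF assms(1,2,4)] by metis
  define c where "c = B * (2 / (1 - \<kappa>))"
  define d where "d = B * (10 / (1 - \<kappa>) ^ 2)"
  have cd: "0 \<le> c" "0 \<le> d" using \<kappa> by (simp_all add: c_def d_def)
  have "L1_norm (noerlund_maximal q f) \<le> ennreal (c + d) * H1_norm f" for f
  proof -
    let ?M = "running_max f"
    let ?\<sigma> = dyadic_quotient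
    define \<Delta> where "\<Delta> k t = ?M (Suc k) t - ?M k t" for k t
    have [measurable]: "running_max f k \<in> borel_measurable unit_measure" for k
      by (rule borel_measurable_unit) simp
    have [measurable]: "\<Delta> k \<in> borel_measurable unit_measure" for k
      unfolding \<Delta>_def[abs_def] by measurable
    have \<Delta>: "0 \<le> \<Delta> k t" for k t using running_max_mono[of f k t] by (simp add: \<Delta>_def)
    \<comment> \<open>The part of the \<open>m\<close>-th majorant that sees the \<open>k\<close>-th increment: off the diagonal at scale \<open>k + 1\<close>.\<close>
    define F where "F m k x t = ennreal (\<Delta> k t) *
        ennreal (off_interval (Suc k) (?\<sigma> x t) * bump_majorant \<kappa> m (?\<sigma> x t))" for m k x t
    define h where "h m x = (\<Sum>k\<le>m. \<integral>\<^sup>+ t. F m k x t \<partial>unit_measure)" for m x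
    have F_measurable: "(\<lambda>(x, t). F m k x t) \<in> borel_measurable (unit_measure \<Otimes>\<^sub>M unit_measure)" for m k
    proof -
      have [measurable]: "(\<lambda>z. fst z) \<in> borel_measurable (unit_measure \<Otimes>\<^sub>M unit_measure)"
        "(\<lambda>z. snd z) \<in> borel_measurable (unit_measure \<Otimes>\<^sub>M unit_measure)"
        by (rule measurable_compose[OF measurable_fst borel_ident_unit]
            measurable_compose[OF measurable_snd borel_ident_unit])+
      show ?thesis unfolding F_def split_beta by measurable
    qed
    have [measurable]: "(\<lambda>t. F m k x t) \<in> borel_measurable unit_measure" for m k x
      unfolding F_def by measurable
    have h_measurable [measurable]: "h m \<in> borel_measurable unit_measure" for m
      unfolding h_def[abs_def]
      using unit.borel_measurable_nn_integral[OF F_measurable] by measurable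

    have mean_le: "ennreal \<bar>noerlund_mean q n f x\<bar>
        \<le> ennreal c * ennreal (?M (Suc m) x) + ennreal B * h m x"
      if m: "2 ^ m \<le> n" "n < 2 ^ Suc m" for n m x
    proof -
      let ?g = "walsh_partial_sum (2 ^ Suc m) f"
      let ?K = "\<lambda>t. noerlund_kernel q (?\<sigma> x t) n"
      let ?\<Psi> = "\<lambda>t. bump_majorant \<kappa> m (?\<sigma> x t)"
      have \<Psi>: "0 \<le> ?\<Psi> t" for t
        using bump_majorant_nonneg[OF signs_dyadic_quotient] \<kappa> by simp
      have n: "1 \<le> n" using m(1) by (metis le_trans one_le_numeral one_le_power)
      have "weight_sum q 1 \<le> weight_sum q n" by (rule weight_sum_mono[OF assms(1,2) n])
      then have Q: "0 < weight_sum q n" using assms(3) by (simp add: weight_sum_def)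
      have "noerlund_mean q n f x = noerlund_mean q n ?g x"
        by (rule noerlund_mean_partial_sum[symmetric]) (use m in simp)
      also have "\<dots> = (LINT t|unit_measure. ?g t * ?K t / weight_sum q n)"
        unfolding noerlund_mean_eq_integral[OF integrable_partial_sum] by simp
      finally have "ennreal \<bar>noerlund_mean q n f x\<bar>
          \<le> (\<integral>\<^sup>+ t. ennreal (norm (?g t * ?K t / weight_sum q n)) \<partial>unit_measure)"
        using ennreal_norm_integral_le[of unit_measure "\<lambda>t. ?g t * ?K t / weight_sum q n"]
        by (simp only: real_norm_def)
      also have "\<dots> \<le> (\<integral>\<^sup>+ t. ennreal (?M (Suc m) x) * (ennreal B * ennreal (?\<Psi> t))
          + ennreal B * (\<Sum>k\<le>m. F m k x t) \<partial>unit_measure)"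
      proof (rule nn_integral_mono)
        fix t
        have "\<bar>?g t * ?K t / weight_sum q n\<bar> = \<bar>?g t\<bar> * (\<bar>?K t\<bar> / weight_sum q n)"
          using Q by (simp add: abs_mult)
        also have "\<dots> \<le> ?M (Suc m) t * (B * ?\<Psi> t)"
          using maj[OF signs_dyadic_quotient m] Q running_max_nonneg
          by (intro mult_mono abs_partial_sum_le_running_max) (auto simp: pos_divide_le_eq mult.commute)
        also have "\<dots> \<le> (?M (Suc m) x + (\<Sum>k<Suc m. \<Delta> k t * off_interval (Suc k) (?\<sigma> x t))) * (B * ?\<Psi> t)"
          using running_max_telescope[of f "Suc m" t x] \<Psi> \<kappa>
          by (intro mult_right_mono) (auto simp: \<Delta>_def)
        also have "\<dots> = ?M (Suc m) x * (B * ?\<Psi> t)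
            + B * (\<Sum>k\<le>m. \<Delta> k t * (off_interval (Suc k) (?\<sigma> x t) * ?\<Psi> t))"
          unfolding lessThan_Suc_atMost distrib_right sum_distrib_right
          by (simp only: sum_distrib_left mult_ac)
        finally have "ennreal (norm (?g t * ?K t / weight_sum q n)) \<le> ennreal (?M (Suc m) x * (B * ?\<Psi> t)
            + B * (\<Sum>k\<le>m. \<Delta> k t * (off_interval (Suc k) (?\<sigma> x t) * ?\<Psi> t)))"
          by (simp add: ennreal_leI)
        also have "\<dots> = ennreal (?M (Suc m) x) * (ennreal B * ennreal (?\<Psi> t)) + ennreal B * (\<Sum>k\<le>m. F m k x t)"
        proof -
          have nn: "0 \<le> \<Delta> k t * (off_interval (Suc k) (?\<sigma> x t) * ?\<Psi> t)" for k
            by (intro mult_nonneg_nonneg \<Delta> \<Psi> off_interval_nonneg signs_dyadic_quotient)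
          have "(\<Sum>k\<le>m. F m k x t) = ennreal (\<Sum>k\<le>m. \<Delta> k t * (off_interval (Suc k) (?\<sigma> x t) * ?\<Psi> t))"
            unfolding F_def ennreal_mult'[OF \<Delta>, symmetric] using nn by (simp add: sum_ennreal)
          then show ?thesis
            using nn \<Psi>[of t] \<kappa> running_max_nonneg[of f "Suc m" x]
            by (simp add: ennreal_plus ennreal_mult sum_nonneg)
        qed
        finally show "ennreal (norm (?g t * ?K t / weight_sum q n))
          \<le> ennreal (?M (Suc m) x) * (ennreal B * ennreal (?\<Psi> t)) + ennreal B * (\<Sum>k\<le>m. F m k x t)" .
      qed
      also have "\<dots> = ennreal (?M (Suc m) x) * (ennreal B * (\<integral>\<^sup>+ t. ennreal (?\<Psi> t) \<partial>unit_measure))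
          + ennreal B * h m x"
        by (simp add: nn_integral_add nn_integral_cmult nn_integral_sum h_def)
      also have "\<dots> \<le> ennreal (?M (Suc m) x) * ennreal c + ennreal B * h m x"
      proof (intro add_right_mono mult_left_mono)
        have "(\<integral>\<^sup>+ t. ennreal (?\<Psi> t) \<partial>unit_measure) = ennreal (LINT t|unit_measure. ?\<Psi> t)"
          by (rule nn_integral_eq_integral) (use \<Psi> in auto)
        also have "\<dots> \<le> ennreal (2 / (1 - \<kappa>))"
          by (rule ennreal_leI[OF integral_bump_majorant_le[OF \<kappa>(1,2)]])
        finally have "ennreal B * (\<integral>\<^sup>+ t. ennreal (?\<Psi> t) \<partial>unit_measure) \<le> ennreal B * ennreal (2 / (1 - \<kappa>))"
          by (rule mult_left_mono) simp
        also have "\<dots> = ennreal c"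
          unfolding c_def by (rule ennreal_mult[symmetric]) (use \<kappa> in auto)
        finally show "ennreal B * (\<integral>\<^sup>+ t. ennreal (?\<Psi> t) \<partial>unit_measure) \<le> ennreal c" .
      qed simp
      finally show ?thesis by (simp only: mult.commute)
    qed

    have maximal_le: "noerlund_maximal q f x
        \<le> ennreal c * dyadic_maximal f x + ennreal B * (\<Sum>m. h m x)" for x
      unfolding noerlund_maximal_def
    proof (rule SUP_least)
      fix n :: nat assume "n \<in> {1..}"
      then obtain m where m: "2 ^ m \<le> n" "n < 2 ^ Suc m" using ex_dyadic_block[of n] by auto
      have "h m x = (\<Sum>m\<in>{m}. h m x)" by simp
      also have "\<dots> \<le> (\<Sum>m. h m x)" by (rule sum_le_suminf) auto
      finally show "ennreal \<bar>noerlund_mean q n f x\<bar>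
          \<le> ennreal c * dyadic_maximal f x + ennreal B * (\<Sum>m. h m x)"
        by (intro order_trans[OF mean_le[OF m]] add_mono mult_left_mono running_max_le_dyadic_maximal) auto
    qed

    let ?D = "\<lambda>k. \<integral>\<^sup>+ t. ennreal (\<Delta> k t) \<partial>unit_measure"
    \<comment> \<open>The kernel is symmetric, so the bound for integrals over \<open>t\<close> serves for those over \<open>x\<close>.\<close>
    have int_F: "(\<integral>\<^sup>+ x. (\<integral>\<^sup>+ t. F m k x t \<partial>unit_measure) \<partial>unit_measure)
        \<le> ?D k * ennreal (off_mass \<kappa> m (Suc k))" for m k
    proof -
      interpret pair_sigma_finite unit_measure unit_measure ..
      have "(\<integral>\<^sup>+ x. (\<integral>\<^sup>+ t. F m k x t \<partial>unit_measure) \<partial>unit_measure)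
          = (\<integral>\<^sup>+ t. (\<integral>\<^sup>+ x. F m k x t \<partial>unit_measure) \<partial>unit_measure)"
        by (rule Fubini'[OF F_measurable, symmetric])
      also have "\<dots> \<le> (\<integral>\<^sup>+ t. ennreal (\<Delta> k t) * ennreal (off_mass \<kappa> m (Suc k)) \<partial>unit_measure)"
      proof (rule nn_integral_mono)
        fix t
        have "(\<integral>\<^sup>+ x. F m k x t \<partial>unit_measure) = ennreal (\<Delta> k t) * (\<integral>\<^sup>+ x.
            ennreal (off_interval (Suc k) (?\<sigma> t x) * bump_majorant \<kappa> m (?\<sigma> t x)) \<partial>unit_measure)"
          unfolding F_def dyadic_quotient_commute[of _ t] by (rule nn_integral_cmult) measurable
        also have "\<dots> \<le> ennreal (\<Delta> k t) * ennreal (off_mass \<kappa> m (Suc k))"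
          by (intro mult_left_mono nn_integral_bump_majorant_off_interval \<kappa>) simp
        finally show "(\<integral>\<^sup>+ x. F m k x t \<partial>unit_measure)
            \<le> ennreal (\<Delta> k t) * ennreal (off_mass \<kappa> m (Suc k))" .
      qed
      also have "\<dots> = ?D k * ennreal (off_mass \<kappa> m (Suc k))" by (rule nn_integral_multc) measurable
      finally show ?thesis .
    qed
    have int_h: "(\<integral>\<^sup>+ x. h m x \<partial>unit_measure) \<le> (\<Sum>k\<le>m. ?D k * ennreal (off_mass \<kappa> m (Suc k)))" for m
    proof -
      have "(\<lambda>x. \<integral>\<^sup>+ t. F m k x t \<partial>unit_measure) \<in> borel_measurable unit_measure" for k
        using unit.borel_measurable_nn_integral[OF F_measurable] by simp
      then have "(\<integral>\<^sup>+ x. h m x \<partial>unit_measure)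
          = (\<Sum>k\<le>m. \<integral>\<^sup>+ x. (\<integral>\<^sup>+ t. F m k x t \<partial>unit_measure) \<partial>unit_measure)"
        unfolding h_def by (intro nn_integral_sum)
      then show ?thesis by (simp add: sum_mono int_F)
    qed

    have partial: "(\<Sum>m<n. \<integral>\<^sup>+ x. h m x \<partial>unit_measure) \<le> ennreal (10 / (1 - \<kappa>) ^ 2) * H1_norm f" for n
    proof -
      have "(\<Sum>m<n. \<integral>\<^sup>+ x. h m x \<partial>unit_measure)
          \<le> (\<Sum>m<n. \<Sum>k\<le>m. ?D k * ennreal (off_mass \<kappa> m (Suc k)))"
        by (rule sum_mono) (rule int_h)
      also have "\<dots> = (\<Sum>k<n. ?D k * (\<Sum>m = k..<n. ennreal (off_mass \<kappa> m (Suc k))))"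
        unfolding sum_triangle_swap by (simp add: sum_distrib_left)
      also have "\<dots> \<le> (\<Sum>k<n. ?D k * ennreal (10 / (1 - \<kappa>) ^ 2))"
      proof (intro sum_mono mult_left_mono)
        fix k
        have "0 \<le> off_mass \<kappa> m (Suc k)" for m
          unfolding off_mass_def using \<kappa> by (intro sum_nonneg) auto
        then show "(\<Sum>m = k..<n. ennreal (off_mass \<kappa> m (Suc k))) \<le> ennreal (10 / (1 - \<kappa>) ^ 2)"
          using sum_off_mass_le[OF \<kappa>(1,2)] by (simp add: sum_ennreal ennreal_leI)
      qed simp
      also have "\<dots> = ennreal (10 / (1 - \<kappa>) ^ 2) * (\<integral>\<^sup>+ t. (\<Sum>k<n. ennreal (\<Delta> k t)) \<partial>unit_measure)"
        by (simp add: nn_integral_sum sum_distrib_right[symmetric] mult.commute)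
      also have "\<dots> \<le> ennreal (10 / (1 - \<kappa>) ^ 2) * H1_norm f"
        unfolding H1_norm_def L1_norm_def
      proof (intro mult_left_mono nn_integral_mono)
        fix t
        have "(\<Sum>k<n. \<Delta> k t) = ?M n t - ?M 0 t"
          unfolding \<Delta>_def by (rule sum_lessThan_telescope)
        then have "(\<Sum>k<n. ennreal (\<Delta> k t)) \<le> ennreal (?M n t)"
          using \<Delta> running_max_nonneg[of f 0 t] by (simp add: sum_ennreal ennreal_leI)
        then show "(\<Sum>k<n. ennreal (\<Delta> k t)) \<le> dyadic_maximal f t"
          using running_max_le_dyadic_maximal by (rule order_trans)
      qed simp
      finally show ?thesis .
    qed

    have "L1_norm (noerlund_maximal q f)
        \<le> (\<integral>\<^sup>+ x. ennreal c * dyadic_maximal f x + ennreal B * (\<Sum>m. h m x) \<partial>unit_measure)"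
      unfolding L1_norm_def by (intro nn_integral_mono maximal_le)
    also have "\<dots> = ennreal c * H1_norm f + ennreal B * (\<Sum>m. \<integral>\<^sup>+ x. h m x \<partial>unit_measure)"
      unfolding H1_norm_def L1_norm_def
      by (simp add: nn_integral_add nn_integral_cmult nn_integral_suminf)
    also have "\<dots> \<le> ennreal c * H1_norm f + ennreal B * (ennreal (10 / (1 - \<kappa>) ^ 2) * H1_norm f)"
      by (intro add_left_mono mult_left_mono suminf_le_const partial) auto
    also have "\<dots> = ennreal (c + d) * H1_norm f"
    proof -
      have "ennreal d = ennreal B * ennreal (10 / (1 - \<kappa>) ^ 2)"
        unfolding d_def by (rule ennreal_mult) (use \<kappa> in auto)
      then show ?thesis using cd by (simp only: ennreal_plus distrib_right mult.assoc)
    qed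
    finally show ?thesis .
  qed
  then show ?thesis unfolding bounded_between_def by blast
qed

section \<open>Boundedness of the maximal operator bounds the kernels\<close>

definition kernel_norm :: "(nat \<Rightarrow> real) \<Rightarrow> nat \<Rightarrow> real" where
  "kernel_norm q n = (LINT t|unit_measure. \<bar>noerlund_kernel q (dyadic_quotient 0 t) n\<bar>)"

lemma rademacher_0: "rademacher 0 j = 1"
  by (simp add: rademacher_def dyadic_digit_def)

lemma walsh_eq_walsh_char_0: "walsh i x = walsh_char (dyadic_quotient 0 x) i"
proof -
  have "dyadic_quotient 0 x = rademacher x"
    by (simp add: fun_eq_iff dyadic_quotient_def rademacher_0)
  then show ?thesis by (simp add: walsh_eq_walsh_char)
qed

lemma rademacher_near_0:
  assumes "0 \<le> x" "x < 1 / 2 ^ n" "j < n"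
  shows "rademacher x j = 1"
proof -
  have "2 ^ (j + 1) * x < 2 ^ (j + 1) * (1 / 2 ^ n)"
    by (rule mult_strict_left_mono) (use assms in auto)
  also have "\<dots> \<le> 1"
    using power_increasing[of "j + 1" n "2::real"] assms(3) by (simp add: field_simps)
  finally have "\<lfloor>2 ^ (j + 1) * x\<rfloor> = 0" using assms(1) by (simp add: floor_eq_iff)
  then show ?thesis by (simp add: rademacher_def dyadic_digit_def)
qed

lemma noerlund_kernel_near_0:
  assumes "0 \<le> x" "x < 1 / 2 ^ n"
  shows "noerlund_kernel q (dyadic_quotient x t) n = noerlund_kernel q (dyadic_quotient 0 t) n"
  unfolding noerlund_kernel_def
proof (rule sum.cong)
  fix i assume "i \<in> {..<n}"
  then have "i < 2 ^ n" by (metis lessThan_iff less_exp less_trans)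
  then have "walsh i x = walsh i 0"
    by (rule walsh_locally_constant[rotated])
      (use assms in \<open>simp add: dyadic_quotient_def rademacher_0 rademacher_near_0\<close>)
  then show "weight_sum q (n - i) * walsh_char (dyadic_quotient x t) i
      = weight_sum q (n - i) * walsh_char (dyadic_quotient 0 t) i"
    by (simp add: walsh_char_dyadic_quotient)
qed simp

lemma ex_near_0_of_AE:
  assumes "AE x in unit_measure. P x"
  obtains x where "0 \<le> x" "x < 1 / 2 ^ n" "P x"
proof -
  have le1: "1 / 2 ^ n \<le> (1::real)" by simp
  then have "emeasure unit_measure {0..<1 / 2 ^ n} = ennreal (1 / 2 ^ n)"
    by (subst emeasure_restrict_space) auto
  then have ne: "emeasure unit_measure {0..<1 / 2 ^ n} \<noteq> 0" by (simp add: ennreal_eq_0_iff not_le)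
  have "\<not> (AE x in unit_measure. x \<notin> {0..<1 / 2 ^ n})"
  proof
    assume ae: "AE x in unit_measure. x \<notin> {0..<1 / 2 ^ n}"
    have "{x \<in> space unit_measure. \<not> x \<notin> {0..<1 / 2 ^ n}} = {0..<1 / 2 ^ n}"
      by (auto intro: less_le_trans[OF _ le1])
    moreover have "{0..<1 / 2 ^ n :: real} \<in> sets unit_measure"
      using le1 by (auto simp: sets_restrict_space_iff)
    ultimately show False using ae ne by (subst (asm) AE_iff_measurable) auto
  qed
  then have "\<not> (\<forall>x. P x \<longrightarrow> x \<notin> {0..<1 / 2 ^ n})"
    using eventually_mono[OF assms] by metis
  then show ?thesis using that by auto
qed

text \<open>For \<open>f = sgn N\<^sub>n\<close> the mean \<open>t\<^sub>n f\<close> equals \<open>\<parallel>N\<^sub>n\<parallel>\<^sub>1 / Q\<^sub>n\<close> at 0. As the kernel of index \<open>n\<close> sees only the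
  first \<open>n\<close> digits, this value is taken on a whole interval, so an almost everywhere bound
  applies to it.\<close>
lemma kernel_norm_le_of_Linf_bounded:
  assumes "bounded_between Linf_space (\<lambda>f. Linf_norm (\<lambda>x. ennreal \<bar>f x\<bar>)) Linf_norm (noerlund_maximal q)"
    and "\<And>k. 0 \<le> q k" "0 < q 0"
  obtains C where "0 \<le> C" "\<And>n. 1 \<le> n \<Longrightarrow> kernel_norm q n \<le> C * weight_sum q n"
proof -
  obtain c where c: "\<And>f. f \<in> Linf_space \<Longrightarrow>
      Linf_norm (noerlund_maximal q f) \<le> ennreal c * Linf_norm (\<lambda>x. ennreal \<bar>f x\<bar>)"
    using assms(1) unfolding bounded_between_def by blast
  have "kernel_norm q n \<le> \<bar>c\<bar> * weight_sum q n" if n: "1 \<le> n" for n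
  proof -
    let ?K = "\<lambda>t. noerlund_kernel q (dyadic_quotient 0 t) n"
    define f where "f t = sgn (?K t)" for t
    have [measurable]: "f \<in> borel_measurable unit_measure" unfolding f_def[abs_def] by measurable
    have f1: "\<bar>f t\<bar> \<le> 1" for t by (simp add: f_def abs_sgn_eq)
    have norm_f: "Linf_norm (\<lambda>x. ennreal \<bar>f x\<bar>) \<le> 1"
      unfolding Linf_norm_def by (rule esssup_I) (use f1 in auto)
    then have "f \<in> Linf_space" by (auto simp: Linf_space_def le_less_trans[OF _ ennreal_one_less_top])
    then have "Linf_norm (noerlund_maximal q f) \<le> ennreal c * 1"
      using c mult_left_mono[OF norm_f] order_trans by (metis zero_le)
    then have le: "esssup unit_measure (noerlund_maximal q f) \<le> ennreal \<bar>c\<bar>"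
      by (simp add: Linf_norm_def) (meson abs_ge_self ennreal_leI order_trans)
    have "AE x in unit_measure. noerlund_maximal q f x \<le> ennreal \<bar>c\<bar>"
      using esssup_AE[of "noerlund_maximal q f" unit_measure] by eventually_elim (use le in auto)
    then obtain x where x: "0 \<le> x" "x < 1 / 2 ^ n" and T: "noerlund_maximal q f x \<le> ennreal \<bar>c\<bar>"
      by (rule ex_near_0_of_AE)
    have "ennreal \<bar>noerlund_mean q n f x\<bar> \<le> noerlund_maximal q f x"
      unfolding noerlund_maximal_def by (rule SUP_upper) (use n in simp)
    with T have "ennreal \<bar>noerlund_mean q n f x\<bar> \<le> ennreal \<bar>c\<bar>" by (rule order_trans[rotated])
    then have mean: "noerlund_mean q n f x \<le> \<bar>c\<bar>" by (simp add: ennreal_le_iff)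
    have "integrable unit_measure f" by (rule integrable_bounded) (use f1 in auto)
    then have "noerlund_mean q n f x = kernel_norm q n / weight_sum q n"
      by (simp add: noerlund_mean_eq_integral noerlund_kernel_near_0[OF x] kernel_norm_def f_def
          abs_sgn mult.commute)
    moreover have "0 < weight_sum q n"
      unfolding weight_sum_def by (rule sum_pos2[of _ 0]) (use assms n in auto)
    ultimately show ?thesis using mean by (simp add: pos_divide_le_eq)
  qed
  then show ?thesis using that[of "\<bar>c\<bar>"] by simp
qed

text \<open>The test function \<open>f = w(2\<^sup>A) D(2\<^sup>A)\<close> is an atom: its partial sums of order \<open>2\<^sup>k\<close> are \<open>0\<close> or \<open>f\<close>,
  hence its Hardy norm is 1. The mean of index \<open>2\<^sup>A + n\<close> turns it into \<open>w(2\<^sup>A) N\<^sub>n\<close> divided by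
  \<open>Q(2\<^sup>A + n)\<close>, and choosing \<open>n < 2\<^sup>A \<le> 2 n\<close> makes the latter at most \<open>3 Q\<^sub>n\<close>.\<close>
lemma kernel_norm_le_of_H1_bounded:
  assumes "bounded_between H1_space H1_norm L1_norm (noerlund_maximal q)"
    and "decseq q" "\<And>k. 0 \<le> q k" "0 < q 0"
  obtains C where "0 \<le> C" "\<And>n. 1 \<le> n \<Longrightarrow> kernel_norm q n \<le> C * weight_sum q n"
proof -
  obtain c where c: "\<And>f. f \<in> H1_space \<Longrightarrow> L1_norm (noerlund_maximal q f) \<le> ennreal c * H1_norm f"
    using assms(1) unfolding bounded_between_def by blast
  have "kernel_norm q n \<le> 3 * \<bar>c\<bar> * weight_sum q n" if n: "1 \<le> n" for n
  proof -
    obtain m where m: "2 ^ m \<le> n" "n < 2 ^ Suc m" using ex_dyadic_block[OF n] .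
    define A where "A = Suc m"
    define a where "a i = (if i < 2 ^ A then 0 else 1 :: real)" for i :: nat
    \<comment> \<open>This is \<open>w(2\<^sup>A) D(2\<^sup>A)\<close>, as a Walsh polynomial so that its coefficients are known.\<close>
    define f where "f = (\<lambda>x. \<Sum>i<2 ^ Suc A. a i * walsh i x)"
    let ?\<sigma> = "dyadic_quotient 0"
    let ?N = "2 ^ A + n"
    have n_less: "n < 2 ^ A" using m by (simp add: A_def)
    have coeff: "walsh_coeff f i = (if i < 2 ^ Suc A then a i else 0)" for i
      unfolding f_def by (rule walsh_coeff_polynomial)
    have f_eq: "f x = ?\<sigma> x A * dirichlet (?\<sigma> x) (2 ^ A)" for x
    proof -
      have "f x = (\<Sum>i<2 ^ A + 2 ^ A. a i * walsh i x)" by (simp add: f_def mult_2)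
      also have "\<dots> = (\<Sum>i<2 ^ A. walsh (2 ^ A + i) x)"
        unfolding sum_lessThan_add by (simp add: a_def)
      also have "\<dots> = (\<Sum>i<2 ^ A. ?\<sigma> x A * walsh_char (?\<sigma> x) i)"
        unfolding walsh_eq_walsh_char_0 by (intro sum.cong) (auto simp: walsh_char_power2_add)
      finally show ?thesis by (simp add: dirichlet_def sum_distrib_left)
    qed
    have abs_f: "\<bar>f x\<bar> = dirichlet (?\<sigma> x) (2 ^ A)" for x
      unfolding f_eq abs_mult signs_abs[OF signs_dyadic_quotient]
      using dirichlet_power2_bounds(1)[OF signs_dyadic_quotient] by simp
    have partial: "\<bar>walsh_partial_sum (2 ^ k) f x\<bar> \<le> dirichlet (?\<sigma> x) (2 ^ A)" for k x
    proof (cases "k \<le> A")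
      case True
      have "walsh_partial_sum (2 ^ k) f x = 0"
        unfolding walsh_partial_sum_def coeff
      proof (intro sum.neutral ballI)
        fix i :: nat assume "i \<in> {..<2 ^ k}"
        moreover have "(2::nat) ^ k \<le> 2 ^ A" using True by simp
        ultimately have "i < 2 ^ A" by (metis lessThan_iff less_le_trans)
        then show "(if i < 2 ^ Suc A then a i else 0) * walsh i x = 0" by (simp add: a_def)
      qed
      then show ?thesis using dirichlet_power2_bounds(1)[OF signs_dyadic_quotient] by simp
    next
      case False
      then have le: "(2::nat) ^ Suc A \<le> 2 ^ k" by (intro power_increasing) auto
      have "walsh_partial_sum (2 ^ k) f x = f x"
        unfolding walsh_partial_sum_def coeff
        by (subst f_def, rule sum.mono_neutral_cong_right) (use le in auto)
      then show ?thesis by (simp add: abs_f)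
    qed
    have norm_f: "H1_norm f \<le> 1"
    proof -
      have "H1_norm f \<le> (\<integral>\<^sup>+ x. ennreal (dirichlet (?\<sigma> x) (2 ^ A)) \<partial>unit_measure)"
        unfolding H1_norm_def L1_norm_def dyadic_maximal_def
        by (intro nn_integral_mono SUP_least ennreal_leI partial)
      also have "\<dots> = ennreal (LINT x|unit_measure. dirichlet (?\<sigma> x) (2 ^ A))"
        by (rule nn_integral_eq_integral)
          (auto intro: dirichlet_power2_bounds(1)[OF signs_dyadic_quotient])
      finally show ?thesis by (simp add: integral_dirichlet)
    qed
    have "f \<in> borel_measurable borel" unfolding f_def by measurable
    then have "integrable unit_measure f"
      by (intro integrable_bounded[where B = "2 ^ A"] borel_measurable_unit)
        (simp_all add: abs_f dirichlet_power2_bounds signs_dyadic_quotient)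
    then have "f \<in> H1_space"
      using norm_f by (auto simp: H1_space_def le_less_trans[OF _ ennreal_one_less_top])
    then have "L1_norm (noerlund_maximal q f) \<le> ennreal c * 1"
      using c mult_left_mono[OF norm_f] order_trans by (metis zero_le)
    then have T: "L1_norm (noerlund_maximal q f) \<le> ennreal \<bar>c\<bar>"
      by simp (meson abs_ge_self ennreal_leI order_trans)

    have "(\<Sum>i<?N. weight_sum q (?N - i) * (walsh_coeff f i * walsh i x))
        = ?\<sigma> x A * noerlund_kernel q (?\<sigma> x) n" for x
      unfolding sum_lessThan_add coeff noerlund_kernel_def walsh_eq_walsh_char_0 sum_distrib_left
      using n_less by (simp add: a_def walsh_char_power2_add mult_ac)
    then have mean: "\<bar>noerlund_mean q ?N f x\<bar> = \<bar>noerlund_kernel q (?\<sigma> x) n\<bar> / \<bar>weight_sum q ?N\<bar>" for x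
      unfolding noerlund_mean_eq_multiplier
      by (simp add: abs_mult signs_abs[OF signs_dyadic_quotient])
    have "ennreal (kernel_norm q n / \<bar>weight_sum q ?N\<bar>)
        = ennreal (LINT x|unit_measure. \<bar>noerlund_mean q ?N f x\<bar>)"
      by (simp add: kernel_norm_def mean)
    also have "\<dots> = (\<integral>\<^sup>+ x. ennreal \<bar>noerlund_mean q ?N f x\<bar> \<partial>unit_measure)"
      by (rule nn_integral_eq_integral[symmetric]) (simp_all add: mean)
    also have "\<dots> \<le> L1_norm (noerlund_maximal q f)"
      unfolding L1_norm_def noerlund_maximal_def
      by (intro nn_integral_mono SUP_upper) (use n in simp)
    also note T
    finally have le: "kernel_norm q n / \<bar>weight_sum q ?N\<bar> \<le> \<bar>c\<bar>" by (simp add: ennreal_le_iff)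
    have Q: "0 < weight_sum q ?N"
      unfolding weight_sum_def by (rule sum_pos2[of _ 0]) (use assms n in auto)
    have "weight_sum q ?N \<le> weight_sum q (2 * n + n)"
      by (rule weight_sum_mono[OF assms(2,3)]) (use m in \<open>simp add: A_def\<close>)
    also have "\<dots> \<le> 3 * weight_sum q n"
      using weight_sum_subadditive[OF assms(2,3), of "2 * n" n] weight_sum_double[OF assms(2,3), of n]
      by linarith
    finally have "\<bar>c\<bar> * weight_sum q ?N \<le> \<bar>c\<bar> * (3 * weight_sum q n)" by (rule mult_left_mono) simp
    then show ?thesis using le Q by (simp add: pos_divide_le_eq)
  qed
  then show ?thesis using that[of "3 * \<bar>c\<bar>"] by simp
qed

section \<open>Bounded kernels force the growth condition\<close>

text \<open>The numbers \<open>1 + 4 + ... + 4\<^sup>s\<^sup>-\<^sup>1\<close>, whose binary digits alternate. The gaps between their digits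
  keep the main terms of the kernel from cancelling.\<close>
primrec alternating :: "nat \<Rightarrow> nat" where
  "alternating 0 = 0"
| "alternating (Suc s) = 2 ^ (2 * s) + alternating s"

lemma three_times_alternating: "3 * alternating s + 1 = 2 ^ (2 * s)"
  by (induction s) auto

lemma alternating_less: "alternating s < 2 ^ (2 * s)"
  using three_times_alternating[of s] by linarith

text \<open>What \<open>noerlund_kernel_power2_add\<close> gives for alternating indices when the sums over Dirichlet
  kernels are dropped at every step.\<close>
primrec alternating_main :: "(nat \<Rightarrow> real) \<Rightarrow> (nat \<Rightarrow> real) \<Rightarrow> nat \<Rightarrow> real" where
  "alternating_main q \<sigma> 0 = 0"
| "alternating_main q \<sigma> (Suc s) = weight_sum q (alternating (Suc s)) * dirichlet \<sigma> (2 ^ (2 * s))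
     + \<sigma> (2 * s) * alternating_main q \<sigma> s"

text \<open>The indicator of \<open>[2\<^sup>-\<^sup>j\<^sup>-\<^sup>1, 2\<^sup>-\<^sup>j)\<close>.\<close>
definition dyadic_shell :: "nat \<Rightarrow> (nat \<Rightarrow> real) \<Rightarrow> real" where
  "dyadic_shell j \<sigma> = off_interval (Suc j) \<sigma> - off_interval j \<sigma>"

lemma integrable_dyadic_shell [simp]:
  "integrable unit_measure (\<lambda>t. dyadic_shell j (dyadic_quotient x t))"
  by (simp add: dyadic_shell_def off_interval_def)

lemma integral_dyadic_shell:
  "(LINT t|unit_measure. dyadic_shell j (dyadic_quotient x t)) = 1 / 2 ^ Suc j"
  using unit.prob_space
  by (simp add: dyadic_shell_def off_interval_def integral_dirichlet del: power_Suc)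
    (simp add: field_simps)

lemma sum_pairs: "(\<Sum>k<2 * s. g k) = (\<Sum>i<s. g (2 * i) + g (Suc (2 * i)))"
  for g :: "nat \<Rightarrow> real"
  by (induction s) simp_all

context
  fixes q :: "nat \<Rightarrow> real"
  assumes dec: "decseq q" and nonneg: "\<And>k. 0 \<le> q k"
begin

lemma weight_times_power_step:
  "weight_sum q (alternating s) * 2 ^ (2 * s) \<le> weight_sum q (alternating (Suc s)) * 2 ^ (2 * s)"
  by (rule mult_right_mono[OF weight_sum_mono[OF dec nonneg]]) auto

lemma abs_alternating_main_le:
  assumes "signs \<sigma>"
  shows "\<bar>alternating_main q \<sigma> s\<bar> \<le> weight_sum q (alternating s) * 2 ^ (2 * s) / 3"
proof (induction s)
  case 0
  show ?case by (simp add: weight_sum_nonneg[OF dec nonneg])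
next
  case (Suc s)
  let ?Q = "weight_sum q (alternating (Suc s))"
  have "\<bar>alternating_main q \<sigma> (Suc s)\<bar>
      \<le> \<bar>?Q * dirichlet \<sigma> (2 ^ (2 * s))\<bar> + \<bar>\<sigma> (2 * s) * alternating_main q \<sigma> s\<bar>"
    by simp
  also have "\<bar>\<sigma> (2 * s) * alternating_main q \<sigma> s\<bar> = \<bar>alternating_main q \<sigma> s\<bar>"
    by (simp add: abs_mult signs_abs[OF assms])
  also have "\<dots> \<le> ?Q * 2 ^ (2 * s) / 3"
    using Suc weight_times_power_step[of s] by linarith
  also have "\<bar>?Q * dirichlet \<sigma> (2 ^ (2 * s))\<bar> \<le> ?Q * 2 ^ (2 * s)"
    using dirichlet_power2_bounds[OF assms] weight_sum_nonneg[OF dec nonneg]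
    by (simp add: abs_mult mult_left_mono)
  also have "?Q * 2 ^ (2 * s) + ?Q * 2 ^ (2 * s) / 3 = ?Q * 2 ^ (2 * Suc s) / 3" by simp
  finally show ?case by simp
qed

text \<open>On the shell of level \<open>2 i\<close> the Dirichlet kernels of higher order vanish, and the one of
  order \<open>4\<^sup>i\<close> is more than three times the sum of the smaller ones, also after weighting with the
  nondecreasing \<open>Q\<close>. At least two thirds of its value survive.\<close>
lemma alternating_main_lower:
  assumes "signs \<sigma>"
  shows "(\<Sum>i<s. 2 / 3 * 2 ^ (2 * i) * weight_sum q (2 ^ (2 * i)) * dyadic_shell (2 * i) \<sigma>)
    \<le> \<bar>alternating_main q \<sigma> s\<bar>"
proof (induction s)
  case 0
  show ?case by simp
next
  case (Suc s)
  let ?Q = "weight_sum q (alternating (Suc s))"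
  let ?g = "\<lambda>i. 2 / 3 * 2 ^ (2 * i) * weight_sum q (2 ^ (2 * i)) * dyadic_shell (2 * i) \<sigma>"
  show ?case
  proof (cases "\<forall>j<2 * s. \<sigma> j = 1")
    case False
    then have "dirichlet \<sigma> (2 ^ (2 * s)) = 0" using dirichlet_power2[OF assms] by auto
    moreover have "dyadic_shell (2 * s) \<sigma> = 0"
      using False by (auto simp: dyadic_shell_def off_interval_eq[OF assms] less_Suc_eq)
    ultimately show ?thesis using Suc by (simp add: abs_mult signs_abs[OF assms])
  next
    case True
    have "dyadic_shell (2 * i) \<sigma> = 0" if "i < s" for i
      using that True by (auto simp: dyadic_shell_def off_interval_eq[OF assms])
    then have "(\<Sum>i<Suc s. ?g i) = ?g s" by simp
    also have "\<dots> \<le> \<bar>alternating_main q \<sigma> (Suc s)\<bar>"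
    proof (cases "\<sigma> (2 * s) = 1")
      case eq1: True
      then have "dyadic_shell (2 * s) \<sigma> = 0"
        using True by (auto simp: dyadic_shell_def off_interval_eq[OF assms] less_Suc_eq)
      then show ?thesis by simp
    next
      case False
      then have m1: "\<sigma> (2 * s) = - 1" using assms by (auto simp: signs_def)
      then have "dyadic_shell (2 * s) \<sigma> = 1"
        using True by (auto simp: dyadic_shell_def off_interval_eq[OF assms])
      moreover have "alternating_main q \<sigma> (Suc s) = ?Q * 2 ^ (2 * s) - alternating_main q \<sigma> s"
        using True dirichlet_power2[OF assms] m1 by simp
      moreover have "\<bar>alternating_main q \<sigma> s\<bar> \<le> ?Q * 2 ^ (2 * s) / 3"
        using abs_alternating_main_le[OF assms, of s] weight_times_power_step[of s] by linarith
      moreover have "2 ^ (2 * s) * weight_sum q (2 ^ (2 * s)) \<le> ?Q * 2 ^ (2 * s)"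
        unfolding mult.commute[of "2 ^ (2 * s)"]
        by (intro mult_right_mono weight_sum_mono[OF dec nonneg]) auto
      ultimately show ?thesis by (simp only: mult.assoc mult_1_right)
    qed
    finally show ?thesis .
  qed
qed

lemma abs_noerlund_kernel_diff_main_le:
  assumes "signs \<sigma>"
  shows "\<bar>noerlund_kernel q \<sigma> (alternating s) - alternating_main q \<sigma> s\<bar>
    \<le> (\<Sum>i<s. \<Sum>l<2 * i. q (alternating i + 2 ^ l) * fejer_block \<sigma> l)"
proof (induction s)
  case 0
  show ?case by (simp add: noerlund_kernel_def)
next
  case (Suc s)
  let ?e = "walsh_char \<sigma> (2 ^ (2 * s) - 1)
      * (\<Sum>i = 1..2 ^ (2 * s) - 1. q (alternating s + i) * dirichlet \<sigma> i)"
  have "noerlund_kernel q \<sigma> (alternating (Suc s)) - alternating_main q \<sigma> (Suc s)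
      = \<sigma> (2 * s) * (noerlund_kernel q \<sigma> (alternating s) - alternating_main q \<sigma> s) - ?e"
    using noerlund_kernel_power2_add[OF assms alternating_less, of q s] by (simp add: algebra_simps)
  then have "\<bar>noerlund_kernel q \<sigma> (alternating (Suc s)) - alternating_main q \<sigma> (Suc s)\<bar>
      \<le> \<bar>\<sigma> (2 * s) * (noerlund_kernel q \<sigma> (alternating s) - alternating_main q \<sigma> s)\<bar> + \<bar>?e\<bar>"
    by (simp only: abs_triangle_ineq4)
  also have "\<bar>\<sigma> (2 * s) * (noerlund_kernel q \<sigma> (alternating s) - alternating_main q \<sigma> s)\<bar>
      = \<bar>noerlund_kernel q \<sigma> (alternating s) - alternating_main q \<sigma> s\<bar>"
    by (simp add: abs_mult signs_abs[OF assms])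
  also note Suc
  also have "\<bar>?e\<bar> \<le> (\<Sum>l<2 * s. q (alternating s + 2 ^ l) * fejer_block \<sigma> l)"
    by (rule abs_noerlund_error_le[OF dec nonneg assms])
  finally show ?case by simp
qed

text \<open>Cauchy condensation. The bound by a difference of weight sums, rather than by
  \<open>Q(k + 2\<^sup>m)\<close>, is what makes the errors at successive digits telescope.\<close>
lemma condensed_weights_le:
  "(\<Sum>l<m. 2 ^ l * q (k + 2 ^ l)) \<le> 2 * (weight_sum q (k + 2 ^ m) - weight_sum q k)"
proof (cases m)
  case 0
  then show ?thesis using weight_sum_mono[OF dec nonneg, of k "k + 1"] by simp
next
  case (Suc m')
  have "(\<Sum>l\<le>m. 2 ^ l * q (k + 2 ^ l)) \<le> 2 * (weight_sum q (k + 2 ^ m) - weight_sum q k)" for m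
  proof (induction m)
    case 0
    have "q (k + 1) \<le> q k" by (rule decseqD[OF dec]) simp
    then show ?case using nonneg[of k] by (simp add: weight_sum_def)
  next
    case (Suc m)
    have "(\<Sum>i<(2 ^ m :: nat). q (k + 2 ^ Suc m)) \<le> (\<Sum>i<2 ^ m. q (k + 2 ^ m + i))"
      by (intro sum_mono decseqD[OF dec]) simp
    also have "\<dots> = weight_sum q (k + 2 ^ Suc m) - weight_sum q (k + 2 ^ m)"
      using weight_sum_add[of q "k + 2 ^ m" "2 ^ m"] by (simp add: mult_2 add.assoc)
    finally have "2 ^ m * q (k + 2 ^ Suc m) \<le> weight_sum q (k + 2 ^ Suc m) - weight_sum q (k + 2 ^ m)"
      by simp
    then show ?case using Suc by simp
  qed
  from this[of m'] show ?thesis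
    using weight_sum_mono[OF dec nonneg, of "k + 2 ^ m'" "k + 2 ^ m"] Suc
    by (simp add: lessThan_Suc_atMost)
qed

text \<open>Each main term \<open>Q(4\<^sup>i) D(4\<^sup>i)\<close> contributes a fixed multiple of \<open>Q(4\<^sup>i)\<close> on its own shell, and the
  accumulated error has integral at most \<open>4 Q\<^sub>n\<close>.\<close>
lemma sum_weights_le_kernel_norm:
  "(\<Sum>i<s. weight_sum q (2 ^ (2 * i))) \<le> 3 * (kernel_norm q (alternating s) + 4 * weight_sum q (alternating s))"
proof -
  let ?\<sigma> = "dyadic_quotient 0"
  let ?low = "\<lambda>t. \<Sum>i<s. 2 / 3 * 2 ^ (2 * i) * weight_sum q (2 ^ (2 * i)) * dyadic_shell (2 * i) (?\<sigma> t)"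
  let ?err = "\<lambda>t. \<Sum>i<s. \<Sum>l<2 * i. q (alternating i + 2 ^ l) * fejer_block (?\<sigma> t) l"
  let ?K = "\<lambda>t. noerlund_kernel q (?\<sigma> t) (alternating s)"
  have "(\<Sum>i<s. weight_sum q (2 ^ (2 * i))) / 3 = (LINT t|unit_measure. ?low t)"
    by (simp add: Bochner_Integration.integral_sum integral_dyadic_shell sum_divide_distrib field_simps)
  also have "\<dots> \<le> (LINT t|unit_measure. \<bar>?K t\<bar> + ?err t)"
  proof (rule integral_mono)
    fix t
    show "?low t \<le> \<bar>?K t\<bar> + ?err t"
      using alternating_main_lower[OF signs_dyadic_quotient, of 0 t s]
        abs_noerlund_kernel_diff_main_le[OF signs_dyadic_quotient, of 0 t s]
      by linarith
  qed auto
  also have "\<dots> = kernel_norm q (alternating s) + (LINT t|unit_measure. ?err t)"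
    by (subst Bochner_Integration.integral_add) (auto simp: kernel_norm_def)
  also have "(LINT t|unit_measure. ?err t)
      = (\<Sum>i<s. 2 * (\<Sum>l<2 * i. 2 ^ l * q (alternating i + 2 ^ l)))"
    by (simp add: Bochner_Integration.integral_sum integral_fejer_block sum_distrib_left mult_ac)
  also have "\<dots> \<le> (\<Sum>i<s. 4 * (weight_sum q (alternating (Suc i)) - weight_sum q (alternating i)))"
  proof (rule sum_mono)
    fix i
    show "2 * (\<Sum>l<2 * i. 2 ^ l * q (alternating i + 2 ^ l))
        \<le> 4 * (weight_sum q (alternating (Suc i)) - weight_sum q (alternating i))"
      using condensed_weights_le[of "alternating i" "2 * i"] by (simp add: add.commute)
  qed
  also have "\<dots> = 4 * weight_sum q (alternating s)"
    unfolding sum_distrib_left[symmetric]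
      sum_lessThan_telescope[of "\<lambda>i. weight_sum q (alternating i)"] by (simp add: weight_sum_def)
  finally show ?thesis by simp
qed

lemma growth_of_kernel_norm_bounded:
  assumes "0 \<le> C" "\<And>n. 1 \<le> n \<Longrightarrow> kernel_norm q n \<le> C * weight_sum q n"
  shows "(\<Sum>k = 1..m. weight_sum q (2 ^ k)) \<le> 18 * (C + 4) * weight_sum q (2 ^ m)"
proof -
  define s where "s = Suc (m div 2)"
  have "alternating s \<ge> 1" by (simp add: s_def Suc_le_eq)
  have "(\<Sum>k = 1..m. weight_sum q (2 ^ k)) \<le> (\<Sum>k<2 * s. weight_sum q (2 ^ k))"
    by (rule sum_mono2) (auto simp: s_def weight_sum_nonneg[OF dec nonneg])
  also have "\<dots> \<le> (\<Sum>i<s. 3 * weight_sum q (2 ^ (2 * i)))"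
    unfolding sum_pairs
  proof (rule sum_mono)
    fix i
    show "weight_sum q (2 ^ (2 * i)) + weight_sum q (2 ^ Suc (2 * i)) \<le> 3 * weight_sum q (2 ^ (2 * i))"
      using weight_sum_double[OF dec nonneg, of "2 ^ (2 * i)"] by simp
  qed
  also have "\<dots> = 3 * (\<Sum>i<s. weight_sum q (2 ^ (2 * i)))" by (simp add: sum_distrib_left)
  also have "\<dots> \<le> 3 * (3 * (C * weight_sum q (alternating s) + 4 * weight_sum q (alternating s)))"
    using sum_weights_le_kernel_norm[of s] assms(2)[OF \<open>alternating s \<ge> 1\<close>] by simp
  also have "\<dots> = 9 * (C + 4) * weight_sum q (alternating s)" by (simp add: algebra_simps)
  also have "\<dots> \<le> 9 * (C + 4) * (2 * weight_sum q (2 ^ m))"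
  proof (rule mult_left_mono)
    have "(2::nat) ^ (2 * (m div 2)) \<le> 2 ^ m" by (rule power_increasing) auto
    then have "alternating s \<le> 2 * 2 ^ m"
      using three_times_alternating[of "m div 2"] unfolding s_def alternating.simps by linarith
    then show "weight_sum q (alternating s) \<le> 2 * weight_sum q (2 ^ m)"
      using weight_sum_mono[OF dec nonneg] weight_sum_double[OF dec nonneg] order_trans by blast
  qed (use assms in simp)
  finally show ?thesis by (simp add: algebra_simps)
qed

end

section \<open>The equivalence\<close>

lemma top_bit_eq:
  assumes "2 ^ m \<le> n" "n < 2 ^ Suc m"
  shows "top_bit n = m"
proof -
  obtain i where i: "n = 2 ^ m + i" using assms(1) le_Suc_ex by blast
  with assms have i_less: "i < 2 ^ m" by simp
  have bits: "{j. bit n j} = insert m {j. bit i j}" unfolding i by (rule bits_power2_add(1)[OF i_less])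
  show ?thesis unfolding top_bit_def bits
    using finite_bits[of i] bit_imp_less[OF _ i_less] by (intro Max_eqI) (auto intro: less_imp_le)
qed

text \<open>The sum depends on \<open>n\<close> only through its top bit \<open>m\<close>, and \<open>Q(2\<^sup>m) \<le> Q\<^sub>n\<close>, so powers of two are the
  worst case.\<close>
lemma growth_iff_SUP_finite:
  assumes "decseq q" "\<And>k. 0 \<le> q k" "0 < q 0"
  shows "(SUP n\<in>{1..}. ennreal (1 / weight_sum q n * (\<Sum>k = 1..top_bit n. weight_sum q (2 ^ k)))) < \<infinity>
    \<longleftrightarrow> (\<exists>C. \<forall>m. (\<Sum>k = 1..m. weight_sum q (2 ^ k)) \<le> C * weight_sum q (2 ^ m))"
    (is "?S < \<infinity> \<longleftrightarrow> _")
proof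
  have Q: "0 < weight_sum q n" if "1 \<le> n" for n
    unfolding weight_sum_def by (rule sum_pos2[of _ 0]) (use assms that in auto)
  {
    assume fin: "?S < \<infinity>"
    have "(\<Sum>k = 1..m. weight_sum q (2 ^ k)) \<le> enn2real ?S * weight_sum q (2 ^ m)" for m
    proof -
      have top: "top_bit (2 ^ m) = m" by (rule top_bit_eq) auto
      have "ennreal (1 / weight_sum q (2 ^ m) * (\<Sum>k = 1..top_bit (2 ^ m). weight_sum q (2 ^ k))) \<le> ?S"
        by (rule SUP_upper) simp
      also have "?S = ennreal (enn2real ?S)" using fin by simp
      finally have "1 / weight_sum q (2 ^ m) * (\<Sum>k = 1..m. weight_sum q (2 ^ k)) \<le> enn2real ?S"
        by (simp add: top ennreal_le_iff)
      then show ?thesis using Q[of "2 ^ m"] by (simp add: pos_divide_le_eq)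
    qed
    then show "\<exists>C. \<forall>m. (\<Sum>k = 1..m. weight_sum q (2 ^ k)) \<le> C * weight_sum q (2 ^ m)" by blast
  next
    assume "\<exists>C. \<forall>m. (\<Sum>k = 1..m. weight_sum q (2 ^ k)) \<le> C * weight_sum q (2 ^ m)"
    then obtain C where C: "\<And>m. (\<Sum>k = 1..m. weight_sum q (2 ^ k)) \<le> C * weight_sum q (2 ^ m)" by blast
    have "?S \<le> ennreal \<bar>C\<bar>"
    proof (rule SUP_least, rule ennreal_leI)
      fix n :: nat assume "n \<in> {1..}"
      then have n: "1 \<le> n" by simp
      obtain m where m: "2 ^ m \<le> n" "n < 2 ^ Suc m" using ex_dyadic_block[OF n] .
      have "C * weight_sum q (2 ^ m) \<le> \<bar>C\<bar> * weight_sum q n"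
        using Q[of "2 ^ m"] by (intro mult_mono weight_sum_mono[OF assms(1,2) m(1)]) auto
      then show "1 / weight_sum q n * (\<Sum>k = 1..top_bit n. weight_sum q (2 ^ k)) \<le> \<bar>C\<bar>"
        using C[of m] Q[OF n] by (simp add: top_bit_eq[OF m] pos_divide_le_eq)
    qed
    then show "?S < \<infinity>" by (simp add: le_less_trans)
  }
qed

theorem theorem4:
  fixes q :: "nat \<Rightarrow> real"
  assumes "decseq q"
    and "\<And>k. 0 \<le> q k"
    and "0 < q 0"
    and "filterlim (weight_sum q) at_top sequentially"
  shows
    "(bounded_between Linf_space (\<lambda>f. Linf_norm (\<lambda>x. ennreal \<bar>f x\<bar>)) Linf_norm (noerlund_maximal q)
        \<longleftrightarrow> bounded_between H1_space H1_norm L1_norm (noerlund_maximal q)) \<and>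
     (bounded_between H1_space H1_norm L1_norm (noerlund_maximal q)
        \<longleftrightarrow> (SUP n\<in>{1..}. ennreal (1 / weight_sum q n * (\<Sum>k = 1..top_bit n. weight_sum q (2 ^ k)))) < \<infinity>)"
    (is "(?Linf \<longleftrightarrow> ?H1) \<and> (?H1 \<longleftrightarrow> ?S)")
proof -
  let ?G = "\<exists>C. \<forall>m. (\<Sum>k = 1..m. weight_sum q (2 ^ k)) \<le> C * weight_sum q (2 ^ m)"
  have "?Linf" if ?G using that Linf_bounded_of_growth[OF assms(1-3)] by blast
  moreover have "?H1" if ?G using that H1_bounded_of_growth[OF assms(1-3)] by blast
  moreover have ?G if ?Linf
    using kernel_norm_le_of_Linf_bounded[OF that assms(2,3)]
      growth_of_kernel_norm_bounded[OF assms(1,2)] by metis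
  moreover have ?G if ?H1
    using kernel_norm_le_of_H1_bounded[OF that assms(1-3)]
      growth_of_kernel_norm_bounded[OF assms(1,2)] by metis
  moreover note growth_iff_SUP_finite[OF assms(1-3)]
  ultimately show ?thesis by argo
qed

end
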